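(* Let $d\ge3$ and $\mathfrak{s}_c=\frac{d-2}2$. Fix any $0<\epsilon\lesssim1$ and $0<\epsilon_0\lesssim_\epsilon1$. For any two functions $h_+,h_-:\mathbb{R}\times\mathbb{R}^d\to\mathbb{C}$ and any $N_+,N_-\in2^{\mathbb{N}}$ with $N_+\ge N_-$, each of the following four bounds holds: $$\|h_+h_-\|_{L^2_tL^2_x(\mathbb{R}\times\mathbb{R}^d)}\lesssim_{\epsilon_0}N_+^\epsilon\Big(\frac{N_+}{N_-}\Big)^{-\frac12}\times\begin{cases}N_-^{\mathfrak{s}_c}\|h_+\|_{X_{N_+}(\mathbb{R})}\|h_-\|_{X_{N_-}(\mathbb{R})},\\ \|h_+\|_{Y_{N_+}(\mathbb{R})}\|h_-\|_{Y_{N_-}(\mathbb{R})},\\ \|h_+\|_{X_{N_+}(\mathbb{R})}\|h_-\|_{Y_{N_-}(\mathbb{R})},\\ \|h_+\|_{Y_{N_+}(\mathbb{R})}\|h_-\|_{X_{N_-}(\mathbb{R})}.\end{cases}$$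
   Context: "$0<\epsilon\lesssim_A1$" means: for all $0<\epsilon\le\bar\epsilon$, with $\bar\epsilon>0$ sufficiently small depending only on $A$ (and $d$). $2^{\mathbb{N}}=\{1,2,4,\dots\}$, $\mathfrak{c}_0=2\frac{d-1}{d-2}$. Implicit constants depend on $d,\epsilon_0$ only; inequalities with infinite right-hand side are true by convention. For $l\in\{1,\dots,d\}$, $U_{e_l}$ is the Fourier projection in the space variable, $\widehat{U_{e_l}f}=\mathbf{1}_{\mathfrak{U}_{e_l}}\widehat f$ with $\mathfrak{U}_{e_l}=\{\frac{|\xi_l|}{|\xi|}>\frac1{2\sqrt d}\}\setminus\bigcup_{l'<l}\{\frac{|\xi_{l'}|}{|\xi|}>\frac1{2\sqrt d}\}$. Norms. $\|v\|_{L^p_tL^q_x(I)}=\big(\int_I\|v(t)\|_{L^q(\mathbb{R}^d)}^pdt\big)^{1/p}$; writing $x=x_le_l+x_l'$, $$\|v\|_{L^{(\mathfrak{a},\mathfrak{b},\mathfrak{c})}_{e_l}(I)}=\Big(\int_{\mathbb{R}}\Big(\int_I\Big(\int_{\mathbb{R}^{d-1}}|v(t,x_le_l+x_l')|^{\mathfrak{c}}dx_l'\Big)^{\mathfrak{b}/\mathfrak{c}}dt\Big)^{\mathfrak{a}/\mathfrak{b}}dx_l\Big)^{1/\mathfrak{a}}.$$ With $\epsilon_0\in(0,2^{-100})$, $$\begin{aligned}\|v\|_{X_N(I)}&=\|v\|_{L_t^{2/\epsilon_0}L_x^{2/(1-\epsilon_0)}(I)}+\|v\|_{L_t^{2/(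1-\epsilon_0)}L_x^{\frac{2d}{d-2}\frac1{1-\epsilon_0}}(I)}\\&+\sum_{l=1}^d\Big(N^{-\frac{d-1}2}\|v\|_{L_{e_l}^{(\frac2{1-\epsilon_0},\frac2{\epsilon_0},\frac2{\epsilon_0})}(I)}+N^{-\frac12}\|v\|_{L_{e_l}^{(\frac2{1-\epsilon_0},\frac2{\epsilon_0},\frac{\mathfrak{c}_0}{1-\epsilon_0})}(I)}\Big)\\&+\sum_{l=1}^d\Big(N^{\frac12}\|U_{e_l}v\|_{L_{e_l}^{(\frac2{\epsilon_0},\frac2{1-\epsilon_0},\frac2{1-\epsilon_0})}(I)}+N^{-\frac{d-2}2}\|U_{e_l}v\|_{L_{e_l}^{(\frac2{\epsilon_0},\frac2{1-\epsilon_0},\frac2{\epsilon_0})}(I)}\Big),\end{aligned}$$ and $\|v\|_{Y_N(I)}$ is the sum of the same norms with the factor $N^{-\frac{d-1}2}$ replaced by $N^{-\frac12}$ and the factor $N^{-\frac{d-2}2}$ replaced by $N^{\frac12}$. *)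

theory Defs
  imports "HOL-Analysis.Analysis"
begin

text \<open>
  Throughout, \<open>\<real>\<^sup>d\<close> is \<^typ>\<open>real^'n\<close> with \<open>d = CARD('n)\<close>. The index type is linearly ordered,
  so that it is a copy of \<open>{1,\<dots>,d}\<close>: the order enters the definition of the sets \<open>\<UU>\<^sub>l\<close>.
  All norms take values in \<^typ>\<open>ennreal\<close>.
\<close>

text \<open>Real powers of extended nonnegative numbers; only used for positive exponents.\<close>

definition epowr :: "ennreal \<Rightarrow> real \<Rightarrow> ennreal" where
  "epowr x p = (if x = \<infinity> then \<infinity> else ennreal (enn2real x powr p))"


subsection \<open>Fourier transform of tempered functions\<close>

definition schwartz :: "('a::euclidean_space \<Rightarrow> complex) \<Rightarrow> bool" where
  "schwartz \<phi> \<longleftrightarrow>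
     (\<forall>\<alpha>::'a list. set \<alpha> \<subseteq> Basis \<longrightarrow>
        (let \<psi> = foldr (\<lambda>b f x. frechet_derivative f (at x) b) \<alpha> \<phi>
         in (\<forall>x. \<psi> differentiable (at x)) \<and>
            (\<forall>k::nat. bounded (range (\<lambda>x. norm x ^ k *\<^sub>R \<psi> x)))))"

text \<open>
  The normalisation of the Fourier transform is immaterial below: the frequency sets
  \<open>\<UU>\<^sub>l\<close> are invariant under dilations.
\<close>

definition fourier :: "('a::euclidean_space \<Rightarrow> complex) \<Rightarrow> 'a \<Rightarrow> complex" where
  "fourier \<phi> \<xi> = (LINT x|lborel. cis (- (x \<bullet> \<xi>)) * \<phi> x)"

definition tempered :: "('a::euclidean_space \<Rightarrow> complex) \<Rightarrow> bool" where
  "tempered f \<longleftrightarrow> (\<exists>k::nat. integrable lebesgue (\<lambda>x. f x / of_real ((1 + norm x) ^ k)))"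

text \<open>
  The tempered distribution given by \<open>f\<close> has as its Fourier transform the tempered distribution
  given by the function \<open>F\<close>. For \<open>f \<in> L\<^sup>2\<close> such an \<open>F\<close> exists and is the Plancherel transform.
\<close>

definition has_fourier_transform ::
  "('a::euclidean_space \<Rightarrow> complex) \<Rightarrow> ('a \<Rightarrow> complex) \<Rightarrow> bool" where
  "has_fourier_transform f F \<longleftrightarrow> tempered f \<and> tempered F \<and>
     (\<forall>\<phi>. schwartz \<phi> \<longrightarrow> (LINT x|lebesgue. f x * fourier \<phi> x) = (LINT \<xi>|lebesgue. F \<xi> * \<phi> \<xi>))"


subsection \<open>The projections \<open>U\<^sub>l\<close>\<close>

definition freq_set :: "'n::{finite,linorder} \<Rightarrow> (real^'n::{finite,linorder}) set" where
  "freq_set l =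
     {\<xi>. \<bar>\<xi> $ l\<bar> / norm \<xi> > 1 / (2 * sqrt (real CARD('n)))}
     - (\<Union>l'\<in>{l'. l' < l}. {\<xi>. \<bar>\<xi> $ l'\<bar> / norm \<xi> > 1 / (2 * sqrt (real CARD('n)))})"

text \<open>\<open>g = U\<^sub>l f\<close>, for functions of the space variable (up to null sets).\<close>

definition is_U :: "'n::{finite,linorder} \<Rightarrow> (real^'n::{finite,linorder} \<Rightarrow> complex) \<Rightarrow> (real^'n::{finite,linorder} \<Rightarrow> complex) \<Rightarrow> bool" where
  "is_U l f g \<longleftrightarrow>
     (\<exists>F. has_fourier_transform f F \<and> has_fourier_transform g (\<lambda>\<xi>. indicator (freq_set l) \<xi> * F \<xi>))"

text \<open>\<open>w = U\<^sub>l v\<close> on \<open>I \<times> \<real>\<^sup>d\<close>, for functions of time and space (up to null sets).\<close>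

definition is_U_spacetime ::
  "real set \<Rightarrow> 'n::{finite,linorder} \<Rightarrow> (real \<times> (real^'n::{finite,linorder}) \<Rightarrow> complex) \<Rightarrow> (real \<times> (real^'n::{finite,linorder}) \<Rightarrow> complex) \<Rightarrow> bool"
  where
  "is_U_spacetime I l v w \<longleftrightarrow> w \<in> borel_measurable lebesgue \<and>
     (AE t in lborel. t \<in> I \<longrightarrow> is_U l (\<lambda>x. v (t, x)) (\<lambda>x. w (t, x)))"


subsection \<open>Norms\<close>

text \<open>
  The norms are applied to Lebesgue measurable functions. Integrating these against
  \<^const>\<open>lborel\<close> is harmless, as \<open>\<integral>\<^sup>+\<close> agrees for a measure and its completion
  (\<open>nn_integral_completion\<close>).
\<close>

definition norm_LtLx :: "real \<Rightarrow> real \<Rightarrow> real set \<Rightarrow> (real \<times> (real^'n) \<Rightarrow> complex) \<Rightarrow> ennreal" where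
  "norm_LtLx p q I v =
     epowr (\<integral>\<^sup>+t\<in>I. epowr (\<integral>\<^sup>+x. ennreal (norm (v (t, x)) powr q) \<partial>lborel) (p / q) \<partial>lborel) (1 / p)"

text \<open>
  The hyperplane \<open>{x. x $ l = 0} \<cong> \<real>\<^sup>d\<^sup>-\<^sup>1\<close> is parametrised by the coordinates other than \<open>l\<close>;
  \<open>hyperplane_point l s y\<close> is the point \<open>s e\<^sub>l + y\<close>.
\<close>

definition hyperplane_point :: "'n \<Rightarrow> real \<Rightarrow> ('n \<Rightarrow> real) \<Rightarrow> real^'n" where
  "hyperplane_point l s y = (\<chi> i. if i = l then s else y i)"

definition norm_Le ::
  "'n::finite \<Rightarrow> real \<Rightarrow> real \<Rightarrow> real \<Rightarrow> real set \<Rightarrow> (real \<times> (real^'n) \<Rightarrow> complex) \<Rightarrow> ennreal" where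
  "norm_Le l a b c I v =
     epowr (\<integral>\<^sup>+s. epowr (\<integral>\<^sup>+t\<in>I. epowr
         (\<integral>\<^sup>+y. ennreal (norm (v (t, hyperplane_point l s y)) powr c) \<partial>(Pi\<^sub>M (UNIV - {l}) (\<lambda>_. lborel)))
       (b / c) \<partial>lborel) (a / b) \<partial>lborel) (1 / a)"

text \<open>
  The norm of \<open>U\<^sub>l v\<close>. Since \<open>U\<^sub>l v\<close> is unique up to null sets, the infimum ranges over a
  single value; it is \<open>\<infinity>\<close> if \<open>U\<^sub>l v\<close> is undefined, i.e. if the spatial Fourier transform of
  \<open>v\<close> is not a function that can be multiplied by the indicator, or \<open>U\<^sub>l v\<close> is not a function.
\<close>

definition norm_Le_U ::
  "'n::{finite,linorder} \<Rightarrow> real \<Rightarrow> real \<Rightarrow> real \<Rightarrow> real set \<Rightarrow> (real \<times> (real^'n::{finite,linorder}) \<Rightarrow> complex) \<Rightarrow> ennreal"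
  where
  "norm_Le_U l a b c I v = (INF w\<in>{w. is_U_spacetime I l v w}. norm_Le l a b c I w)"

text \<open>
  The common shape of the norms \<open>X\<^sub>N\<close> and \<open>Y\<^sub>N\<close>, which differ only in the exponents \<open>\<alpha>\<close>
  and \<open>\<beta>\<close> of two of the powers of \<open>N\<close>. The parameter \<open>e\<close> is \<open>\<epsilon>\<^sub>0\<close>.
\<close>

definition norm_XY ::
  "real \<Rightarrow> real \<Rightarrow> real \<Rightarrow> nat \<Rightarrow> real set \<Rightarrow> (real \<times> (real^'n::{finite,linorder}) \<Rightarrow> complex) \<Rightarrow> ennreal"
  where
  "norm_XY \<alpha> \<beta> e N I v =
     (let d = real CARD('n); c0 = 2 * (d - 1) / (d - 2) in
      norm_LtLx (2 / e) (2 / (1 - e)) I v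
      + norm_LtLx (2 / (1 - e)) (2 * d / (d - 2) * (1 / (1 - e))) I v
      + (\<Sum>l\<in>UNIV. ennreal (real N powr \<alpha>) * norm_Le l (2 / (1 - e)) (2 / e) (2 / e) I v
                 + ennreal (real N powr (- 1 / 2)) * norm_Le l (2 / (1 - e)) (2 / e) (c0 / (1 - e)) I v)
      + (\<Sum>l\<in>UNIV. ennreal (real N powr (1 / 2)) * norm_Le_U l (2 / e) (2 / (1 - e)) (2 / (1 - e)) I v
                 + ennreal (real N powr \<beta>) * norm_Le_U l (2 / e) (2 / (1 - e)) (2 / e) I v))"

definition norm_X ::
  "real \<Rightarrow> nat \<Rightarrow> real set \<Rightarrow> (real \<times> (real^'n::{finite,linorder}) \<Rightarrow> complex) \<Rightarrow> ennreal" where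
  "norm_X = norm_XY (- (real CARD('n) - 1) / 2) (- (real CARD('n) - 2) / 2)"

definition norm_Y ::
  "real \<Rightarrow> nat \<Rightarrow> real set \<Rightarrow> (real \<times> (real^'n::{finite,linorder}) \<Rightarrow> complex) \<Rightarrow> ennreal" where
  "norm_Y = norm_XY (- 1 / 2) (1 / 2)"

definition dyadic :: "nat set" where
  "dyadic = range (\<lambda>k. 2 ^ k)"

end

theory Submission
  imports Defs "HOL-Probability.Characteristic_Functions" "HOL-Real_Asymp.Real_Asymp"
begin

text \<open>
  Since the sets \<open>\<UU>\<^sub>l\<close> partition the nonzero frequencies, \<open>h\<^sub>+ = \<Sum>\<^sub>l U\<^sub>l h\<^sub>+\<close>, and each
  \<open>U\<^sub>l h\<^sub>+ * h\<^sub>-\<close> is estimated by Hoelder's inequality in the mixed norm adapted to \<open>e\<^sub>l\<close>,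
  with \<open>h\<^sub>-\<close> in \<open>(2/(1-\<epsilon>\<^sub>0), 2/\<epsilon>\<^sub>0, 2/\<epsilon>\<^sub>0)\<close> for the first three bounds. For the last one
  \<open>h\<^sub>-\<close> is taken in \<open>(2/(1-\<epsilon>\<^sub>0), 2/\<epsilon>\<^sub>0, \<c>\<^sub>0/(1-\<epsilon>\<^sub>0))\<close> and \<open>U\<^sub>l h\<^sub>+\<close> is interpolated between
  its two norms, which in \<open>Y\<close> carry the same power of \<open>N\<^sub>+\<close>. No power \<open>N\<^sub>+\<^sup>\<epsilon>\<close> is lost.

  The decomposition and the uniqueness of \<open>U\<^sub>l h\<^sub>+\<close> rest on the fact that a tempered function
  is determined by its integrals against Gaussians, which are the Fourier transforms of
  modulated Gaussians.
\<close>

subsection \<open>Mixed norm Hoelder inequality\<close>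

text \<open>Both norms control N^(1/2) U_l v, and h_- enters with a negative power of N_-. Dividing
  by these weights yields N_+^(-1/2) N_-^(1/2), times the extra N_-^((d-2)/2) that the weight
  N^(-(d-1)/2) of X costs in the first bound. The last bound has no room for this extra factor, so
  h_- must be taken in the norm of X whose weight is N^(-1/2). Its innermost exponent no longer
  pairs with 2/(1-e) in Hoelder's inequality, which forces the interpolation. The obstacle is that
  U_l is a relation between functions, defined by pairing with Schwartz functions, and not an
  operator on L^2. The functions and their transforms are only tempered, so Plancherel is out of
  reach; existence of U_l h_+ has to come from finiteness of the norm. An undefined U_l h_+ gives an
  infinite norm, but infinity times 0 is 0, so this case still has content when the norm of h_-
  vanishes.\<close>

lemma epowr_ennreal [simp]: "0 \<le> r \<Longrightarrow> epowr (ennreal r) p = ennreal (r powr p)"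
  by (simp add: epowr_def)

lemma epowr_top [simp]: "epowr top p = top"
  by (simp add: epowr_def)

lemma epowr_0 [simp]: "epowr 0 p = 0"
  by (simp add: epowr_def)

lemma epowr_1 [simp]: "epowr x 1 = x"
  by (cases x) (auto simp: epowr_def)

lemma epowr_eq_0_iff [simp]: "epowr x p = 0 \<longleftrightarrow> x = 0"
  by (cases x) (auto simp: epowr_def ennreal_eq_0_iff)

lemma epowr_epowr: "epowr (epowr x p) q = epowr x (p * q)"
  by (cases x) (auto simp: epowr_def powr_powr)

text \<open>No sign condition on the exponent: \<open>epowr 0 p = 0\<close> and
  \<open>epowr top p = top\<close> for every \<open>p\<close>, which matches the convention that 0
  times infinity is 0.\<close>

lemma epowr_mult: "epowr (x * y) p = epowr x p * epowr y p"
proof (cases x; cases y)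
  fix r s assume "x = ennreal r" "0 \<le> r" "y = ennreal s" "0 \<le> s"
  then show ?thesis by (simp add: ennreal_mult' [symmetric] powr_mult)
next
  fix r assume "x = ennreal r" "0 \<le> r" "y = top"
  then show ?thesis
    by (cases "r = 0") (auto simp: epowr_def ennreal_mult_top ennreal_eq_0_iff)
next
  fix r assume "x = top" "y = ennreal r" "0 \<le> r"
  then show ?thesis
    by (cases "r = 0") (auto simp: epowr_def ennreal_top_mult ennreal_eq_0_iff)
qed (auto simp: epowr_def)

lemma epowr_add: "epowr x (p + q) = epowr x p * epowr x q"
  by (cases x) (auto simp: epowr_def powr_add ennreal_mult')

lemma epowr_mono: "x \<le> y \<Longrightarrow> 0 \<le> p \<Longrightarrow> epowr x p \<le> epowr y p"
  by (cases x; cases y) (auto simp: epowr_def top_unique intro!: powr_mono2)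

lemma epowr_measurable [measurable]: "(\<lambda>x. epowr x p) \<in> borel_measurable borel"
  unfolding epowr_def by measurable

lemma epowr_2 [simp]: "epowr x 2 = x ^ 2"
  using epowr_add [of x 1 1] by (simp add: power2_eq_square)

lemma epowr_young:
  fixes x y :: ennreal
  assumes "0 < \<alpha>" "0 < \<beta>" "\<alpha> + \<beta> = 1"
  shows "epowr x \<alpha> * epowr y \<beta> \<le> ennreal \<alpha> * x + ennreal \<beta> * y"
proof (cases x; cases y)
  fix r s assume rs: "x = ennreal r" "0 \<le> r" "y = ennreal s" "0 \<le> s"
  have "r powr \<alpha> * s powr \<beta> \<le> \<alpha> * r + \<beta> * s"
    using assms rs Youngs_inequality_0 [of \<alpha> \<beta> r s]
    by (cases "r = 0 \<or> s = 0") (auto simp: less_le)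
  then show ?thesis using rs assms
    by (simp add: ennreal_mult' [symmetric] ennreal_plus [symmetric] del: ennreal_plus)
qed (use assms in \<open>auto simp: ennreal_mult_top\<close>)

text \<open>Scaling both integrals to 1 reduces the claim to the weighted inequality of means
  \<open>epowr_young\<close> under the integral sign. With the powers placed on \<open>F\<close> and
  \<open>G\<close>, the right-hand side is again a product of powers, so the inequality can be
  iterated through the levels of a mixed norm.\<close>

lemma Holder_nn_integral:
  fixes F G :: "'a \<Rightarrow> ennreal"
  assumes [measurable]: "F \<in> borel_measurable M" "G \<in> borel_measurable M"
    and ab: "0 < \<alpha>" "0 < \<beta>" "\<alpha> + \<beta> = 1"
  shows "(\<integral>\<^sup>+x. epowr (F x) \<alpha> * epowr (G x) \<beta> \<partial>M)
    \<le> epowr (\<integral>\<^sup>+x. F x \<partial>M) \<alpha> * epowr (\<integral>\<^sup>+x. G x \<partial>M) \<beta>"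
proof -
  let ?I = "\<integral>\<^sup>+x. F x \<partial>M" and ?J = "\<integral>\<^sup>+x. G x \<partial>M"
  \<comment> \<open>A vanishing integral comes first: only when both are nonzero does an infinite
    one make the right-hand side infinite.\<close>
  consider "?I = 0 \<or> ?J = 0" | "?I \<noteq> 0" "?J \<noteq> 0" "?I = \<infinity> \<or> ?J = \<infinity>"
    | r s where "?I = ennreal r" "?J = ennreal s" "0 < r" "0 < s"
    by (cases ?I; cases ?J) (auto simp: less_le)
  then show ?thesis
  proof cases
    case 1
    then have "(AE x in M. F x = 0) \<or> (AE x in M. G x = 0)"
      by (simp add: nn_integral_0_iff_AE)
    then have "AE x in M. epowr (F x) \<alpha> * epowr (G x) \<beta> = 0"
      by (elim disjE) (auto elim!: eventually_mono)
    then have "(\<integral>\<^sup>+x. epowr (F x) \<alpha> * epowr (G x) \<beta> \<partial>M) = 0"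
      by (subst nn_integral_0_iff_AE) auto
    then show ?thesis by simp
  next
    case 2
    then have "epowr ?I \<alpha> * epowr ?J \<beta> = \<infinity>"
      by (auto simp: ennreal_mult_top ennreal_top_mult)
    then show ?thesis by simp
  next
    case (3 r s)
    define F' where "F' x = F x * ennreal (1 / r)" for x
    define G' where "G' x = G x * ennreal (1 / s)" for x
    have F: "epowr (F x) \<alpha> = ennreal (r powr \<alpha>) * epowr (F' x) \<alpha>" for x
    proof -
      have "F x = ennreal r * F' x"
        using 3 unfolding F'_def mult.left_commute [of "ennreal r"]
        by (simp flip: ennreal_mult)
      then show ?thesis using 3 by (simp add: epowr_mult)
    qed
    have G: "epowr (G x) \<beta> = ennreal (s powr \<beta>) * epowr (G' x) \<beta>" for x
    proof -
      have "G x = ennreal s * G' x"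
        using 3 unfolding G'_def mult.left_commute [of "ennreal s"]
        by (simp flip: ennreal_mult)
      then show ?thesis using 3 by (simp add: epowr_mult)
    qed
    have [measurable]: "F' \<in> borel_measurable M" "G' \<in> borel_measurable M"
      unfolding F'_def G'_def by measurable
    have "(\<integral>\<^sup>+x. F' x \<partial>M) = 1" "(\<integral>\<^sup>+x. G' x \<partial>M) = 1"
      using 3 unfolding F'_def G'_def
      by (simp_all add: nn_integral_multc ennreal_mult' [symmetric])
    then have "(\<integral>\<^sup>+x. ennreal \<alpha> * F' x + ennreal \<beta> * G' x \<partial>M) = ennreal \<alpha> + ennreal \<beta>"
      by (simp add: nn_integral_add nn_integral_cmult)
    also have "\<dots> = 1" using ab by (simp add: ennreal_plus [symmetric] del: ennreal_plus)
    finally have one: "(\<integral>\<^sup>+x. ennreal \<alpha> * F' x + ennreal \<beta> * G' x \<partial>M) = 1" .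
    have "(\<integral>\<^sup>+x. epowr (F x) \<alpha> * epowr (G x) \<beta> \<partial>M)
        = (\<integral>\<^sup>+x. (ennreal (r powr \<alpha>) * ennreal (s powr \<beta>)) * (epowr (F' x) \<alpha> * epowr (G' x) \<beta>) \<partial>M)"
      by (simp add: F G mult_ac)
    also have "\<dots> = ennreal (r powr \<alpha>) * ennreal (s powr \<beta>)
        * (\<integral>\<^sup>+x. epowr (F' x) \<alpha> * epowr (G' x) \<beta> \<partial>M)"
      by (rule nn_integral_cmult) measurable
    also have "\<dots> \<le> ennreal (r powr \<alpha>) * ennreal (s powr \<beta>)
        * (\<integral>\<^sup>+x. ennreal \<alpha> * F' x + ennreal \<beta> * G' x \<partial>M)"
      by (intro mult_left_mono nn_integral_mono epowr_young ab) auto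
    also have "\<dots> = epowr ?I \<alpha> * epowr ?J \<beta>"
      using 3 one by simp
    finally show ?thesis .
  qed
qed

text \<open>The first two factors are grouped as one power \<delta> = \<alpha> + \<beta>; the
  inequality for two factors is used with weights \<delta>, \<gamma> and then with
  \<alpha>/\<delta>, \<beta>/\<delta>.\<close>

lemma Holder3_nn_integral:
  fixes F G H :: "'a \<Rightarrow> ennreal"
  assumes [measurable]: "F \<in> borel_measurable M" "G \<in> borel_measurable M" "H \<in> borel_measurable M"
    and pos: "0 < \<alpha>" "0 < \<beta>" "0 < \<gamma>" and sum: "\<alpha> + \<beta> + \<gamma> = 1"
  shows "(\<integral>\<^sup>+x. epowr (F x) \<alpha> * epowr (G x) \<beta> * epowr (H x) \<gamma> \<partial>M)
    \<le> epowr (\<integral>\<^sup>+x. F x \<partial>M) \<alpha> * epowr (\<integral>\<^sup>+x. G x \<partial>M) \<beta> * epowr (\<integral>\<^sup>+x. H x \<partial>M) \<gamma>"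
proof -
  define \<delta> where "\<delta> = \<alpha> + \<beta>"
  have \<delta>: "0 < \<delta>" "\<delta> + \<gamma> = 1" using pos sum by (auto simp: \<delta>_def)
  have split: "epowr x \<alpha> * epowr y \<beta> = epowr (epowr x (\<alpha> / \<delta>) * epowr y (\<beta> / \<delta>)) \<delta>" for x y
    using \<delta> by (simp add: epowr_mult epowr_epowr)
  have "(\<integral>\<^sup>+x. epowr (F x) \<alpha> * epowr (G x) \<beta> * epowr (H x) \<gamma> \<partial>M)
      \<le> epowr (\<integral>\<^sup>+x. epowr (F x) (\<alpha> / \<delta>) * epowr (G x) (\<beta> / \<delta>) \<partial>M) \<delta> * epowr (\<integral>\<^sup>+x. H x \<partial>M) \<gamma>"
    unfolding split using \<delta> pos by (intro Holder_nn_integral) auto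
  also have "\<dots> \<le> epowr (epowr (\<integral>\<^sup>+x. F x \<partial>M) (\<alpha> / \<delta>) * epowr (\<integral>\<^sup>+x. G x \<partial>M) (\<beta> / \<delta>)) \<delta>
      * epowr (\<integral>\<^sup>+x. H x \<partial>M) \<gamma>"
    using \<delta> pos
    by (intro mult_right_mono epowr_mono Holder_nn_integral) (auto simp: \<delta>_def add_divide_distrib [symmetric])
  finally show ?thesis unfolding split .
qed

text \<open>Hoelder is applied level by level, innermost first; each bound is a product of three
  powers and hence the input of the next level. The conditions \<open>sums\<close> are the scaling
  relations of the levels s, t and y.\<close>

lemma mixed_Holder3:
  fixes u v w :: "('s \<times> 't) \<times> 'y \<Rightarrow> ennreal"
  assumes sf: "sigma_finite_measure T" "sigma_finite_measure Y"
    and [measurable]: "u \<in> borel_measurable ((S \<Otimes>\<^sub>M T) \<Otimes>\<^sub>M Y)"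
      "v \<in> borel_measurable ((S \<Otimes>\<^sub>M T) \<Otimes>\<^sub>M Y)"
      "w \<in> borel_measurable ((S \<Otimes>\<^sub>M T) \<Otimes>\<^sub>M Y)"
    and pos: "a1 > 0" "a2 > 0" "a3 > 0" "b1 > 0" "b2 > 0" "b3 > 0" "c1 > 0" "c2 > 0" "c3 > 0"
      "0 < p" "0 < q" "0 < r"
    and sums: "p / a1 + q / a2 + r / a3 = 1" "p / b1 + q / b2 + r / b3 = 1" "p / c1 + q / c2 + r / c3 = 1"
  shows "(\<integral>\<^sup>+s. \<integral>\<^sup>+t. \<integral>\<^sup>+y. epowr (u ((s, t), y)) p * epowr (v ((s, t), y)) q * epowr (w ((s, t), y)) r \<partial>Y \<partial>T \<partial>S)
    \<le> epowr (\<integral>\<^sup>+s. epowr (\<integral>\<^sup>+t. epowr (\<integral>\<^sup>+y. epowr (u ((s, t), y)) c1 \<partial>Y) (b1 / c1) \<partial>T) (a1 / b1) \<partial>S) (p / a1)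
    * epowr (\<integral>\<^sup>+s. epowr (\<integral>\<^sup>+t. epowr (\<integral>\<^sup>+y. epowr (v ((s, t), y)) c2 \<partial>Y) (b2 / c2) \<partial>T) (a2 / b2) \<partial>S) (q / a2)
    * epowr (\<integral>\<^sup>+s. epowr (\<integral>\<^sup>+t. epowr (\<integral>\<^sup>+y. epowr (w ((s, t), y)) c3 \<partial>Y) (b3 / c3) \<partial>T) (a3 / b3) \<partial>S) (r / a3)"
proof -
  interpret T: sigma_finite_measure T by fact
  interpret Y: sigma_finite_measure Y by fact
  \<comment> \<open>\<open>U1\<close> is the \<open>c1\<close>-th power of the innermost norm, and
    \<open>U2\<close> the \<open>b1\<close>-th power of the norm over t and y; similarly for
    \<open>v\<close> and \<open>w\<close>.\<close>
  define U1 where "U1 s t = (\<integral>\<^sup>+y. epowr (u ((s, t), y)) c1 \<partial>Y)" for s t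
  define V1 where "V1 s t = (\<integral>\<^sup>+y. epowr (v ((s, t), y)) c2 \<partial>Y)" for s t
  define W1 where "W1 s t = (\<integral>\<^sup>+y. epowr (w ((s, t), y)) c3 \<partial>Y)" for s t
  define U2 where "U2 s = (\<integral>\<^sup>+t. epowr (U1 s t) (b1 / c1) \<partial>T)" for s
  define V2 where "V2 s = (\<integral>\<^sup>+t. epowr (V1 s t) (b2 / c2) \<partial>T)" for s
  define W2 where "W2 s = (\<integral>\<^sup>+t. epowr (W1 s t) (b3 / c3) \<partial>T)" for s
  have [measurable]: "(\<lambda>(s, t). U1 s t) \<in> borel_measurable (S \<Otimes>\<^sub>M T)"
      "(\<lambda>(s, t). V1 s t) \<in> borel_measurable (S \<Otimes>\<^sub>M T)"
      "(\<lambda>(s, t). W1 s t) \<in> borel_measurable (S \<Otimes>\<^sub>M T)"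
    unfolding U1_def V1_def W1_def by measurable
  have [measurable]: "U2 \<in> borel_measurable S" "V2 \<in> borel_measurable S" "W2 \<in> borel_measurable S"
    unfolding U2_def V2_def W2_def by measurable
  have 1: "(\<integral>\<^sup>+y. epowr (u ((s, t), y)) p * epowr (v ((s, t), y)) q * epowr (w ((s, t), y)) r \<partial>Y)
      \<le> epowr (U1 s t) (p / c1) * epowr (V1 s t) (q / c2) * epowr (W1 s t) (r / c3)"
    if [simp]: "s \<in> space S" "t \<in> space T" for s t
    using Holder3_nn_integral [of "\<lambda>y. epowr (u ((s, t), y)) c1" Y "\<lambda>y. epowr (v ((s, t), y)) c2"
        "\<lambda>y. epowr (w ((s, t), y)) c3" "p / c1" "q / c2" "r / c3"] pos sums
    by (simp add: epowr_epowr U1_def V1_def W1_def)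
  have 2: "(\<integral>\<^sup>+t. epowr (U1 s t) (p / c1) * epowr (V1 s t) (q / c2) * epowr (W1 s t) (r / c3) \<partial>T)
      \<le> epowr (U2 s) (p / b1) * epowr (V2 s) (q / b2) * epowr (W2 s) (r / b3)"
    if [simp]: "s \<in> space S" for s
    using Holder3_nn_integral [of "\<lambda>t. epowr (U1 s t) (b1 / c1)" T "\<lambda>t. epowr (V1 s t) (b2 / c2)"
        "\<lambda>t. epowr (W1 s t) (b3 / c3)" "p / b1" "q / b2" "r / b3"] pos sums
    by (simp add: epowr_epowr U2_def V2_def W2_def)
  have 3: "(\<integral>\<^sup>+s. epowr (U2 s) (p / b1) * epowr (V2 s) (q / b2) * epowr (W2 s) (r / b3) \<partial>S)
      \<le> epowr (\<integral>\<^sup>+s. epowr (U2 s) (a1 / b1) \<partial>S) (p / a1) * epowr (\<integral>\<^sup>+s. epowr (V2 s) (a2 / b2) \<partial>S) (q / a2)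
        * epowr (\<integral>\<^sup>+s. epowr (W2 s) (a3 / b3) \<partial>S) (r / a3)"
    using Holder3_nn_integral [of "\<lambda>s. epowr (U2 s) (a1 / b1)" S "\<lambda>s. epowr (V2 s) (a2 / b2)"
        "\<lambda>s. epowr (W2 s) (a3 / b3)" "p / a1" "q / a2" "r / a3"] pos sums
    by (simp add: epowr_epowr)
  have "(\<integral>\<^sup>+s. \<integral>\<^sup>+t. \<integral>\<^sup>+y. epowr (u ((s, t), y)) p * epowr (v ((s, t), y)) q * epowr (w ((s, t), y)) r \<partial>Y \<partial>T \<partial>S)
     \<le> (\<integral>\<^sup>+s. \<integral>\<^sup>+t. epowr (U1 s t) (p / c1) * epowr (V1 s t) (q / c2) * epowr (W1 s t) (r / c3) \<partial>T \<partial>S)"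
    by (intro nn_integral_mono 1)
  also have "\<dots> \<le> (\<integral>\<^sup>+s. epowr (U2 s) (p / b1) * epowr (V2 s) (q / b2) * epowr (W2 s) (r / b3) \<partial>S)"
    by (intro nn_integral_mono 2)
  finally show ?thesis
    using 3 unfolding U2_def V2_def W2_def U1_def V1_def W1_def by (rule order_trans)
qed

subsection \<open>Gaussian test functions\<close>

text \<open>The substitution x -> c x with b c^2 = 1/2 turns the integral into the characteristic
  function of the standard normal distribution.\<close>

lemma integral_gauss_cis_real:
  fixes y b :: real
  assumes b: "b > 0"
  shows "integrable lborel (\<lambda>x. of_real (exp (- b * x\<^sup>2)) * cis (x * y) :: complex)" (is ?int)
    and "(LINT x|lborel. of_real (exp (- b * x\<^sup>2)) * cis (x * y))
      = (of_real (sqrt (pi / b) * exp (- y\<^sup>2 / (4 * b))) :: complex)" (is ?eq)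
proof -
  define c where "c = 1 / sqrt (2 * b)"
  have c: "c > 0" "c\<^sup>2 = 1 / (2 * b)" using b by (auto simp: c_def power_divide)
  let ?f = "\<lambda>x. of_real (exp (- b * x\<^sup>2)) * cis (x * y) :: complex"
  have f: "?f (0 + c * x) = of_real (sqrt (2 * pi)) * (std_normal_density x *\<^sub>R iexp ((c * y) * x))" for x
  proof -
    have "- b * (c * x)\<^sup>2 = - x\<^sup>2 / 2" using b by (simp add: power_mult_distrib c)
    then show ?thesis
      by (simp add: std_normal_density_def cis_conv_exp scaleR_conv_of_real mult_ac)
  qed
  interpret N: real_distribution std_normal_distribution by (rule real_dist_normal_dist)
  have "integrable std_normal_distribution (\<lambda>x. iexp ((c * y) * x))"
    by (rule N.integrable_iexp) auto
  then have i: "integrable lborel (\<lambda>x. std_normal_density x *\<^sub>R iexp ((c * y) * x))"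
    by (subst (asm) integrable_density) auto
  then have "integrable lborel (\<lambda>x. ?f (0 + c * x))"
    unfolding f by (intro integrable_mult_right) auto
  then show ?int
    using lborel_integrable_real_affine_iff [of c ?f 0] c by auto
  have "(LINT x|lborel. ?f x) = c *\<^sub>R (LINT x|lborel. ?f (0 + c * x))"
    using lborel_integral_real_affine [of c ?f 0] c by auto
  also have "(LINT x|lborel. ?f (0 + c * x))
      = of_real (sqrt (2 * pi)) * (LINT x|lborel. std_normal_density x *\<^sub>R iexp ((c * y) * x))"
    unfolding f by (rule integral_mult_right_zero)
  also have "(LINT x|lborel. std_normal_density x *\<^sub>R iexp ((c * y) * x)) = char std_normal_distribution (c * y)"
    unfolding char_def by (subst integral_density) auto
  also have "\<dots> = of_real (exp (- y\<^sup>2 / (4 * b)))"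
    by (simp add: char_std_normal_distribution power_mult_distrib c)
  also have "c *\<^sub>R (of_real (sqrt (2 * pi)) * complex_of_real (exp (- y\<^sup>2 / (4 * b))))
      = of_real ((c * sqrt (2 * pi)) * exp (- y\<^sup>2 / (4 * b)))"
    by (simp add: scaleR_conv_of_real)
  also have "c * sqrt (2 * pi) = sqrt (pi / b)"
    using b by (simp add: c_def real_sqrt_mult real_sqrt_divide)
  finally show ?eq .
qed

lemma cis_sum: "finite A \<Longrightarrow> cis (sum f A) = (\<Prod>i\<in>A. cis (f i))"
  by (induction A rule: finite_induct) (auto simp flip: cis_mult)

text \<open>Gaussian and character both factor over the coordinates, so the integral is a product of
  one-dimensional ones.\<close>

lemma integral_gauss_cis:
  fixes y :: "'a::euclidean_space"
  assumes b: "b > 0"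
  shows "integrable lborel (\<lambda>x. of_real (exp (- b * (norm x)\<^sup>2)) * cis (x \<bullet> y) :: complex)" (is ?int)
    and "(LINT x|lborel. of_real (exp (- b * (norm x)\<^sup>2)) * cis (x \<bullet> y))
      = (of_real (sqrt (pi / b) ^ DIM('a) * exp (- (norm y)\<^sup>2 / (4 * b))) :: complex)" (is ?eq)
proof -
  interpret product_sigma_finite "\<lambda>_::'a. lborel::real measure" by standard
  let ?f = "\<lambda>x::'a. of_real (exp (- b * (norm x)\<^sup>2)) * cis (x \<bullet> y) :: complex"
  let ?h = "\<lambda>i x. of_real (exp (- b * x\<^sup>2)) * cis (x * (y \<bullet> i)) :: complex"
  let ?T = "\<lambda>f. \<Sum>i\<in>Basis. f i *\<^sub>R i :: 'a"
  have f: "?f (?T x) = (\<Prod>i\<in>Basis. ?h i (x i))" for x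
  proof -
    have "(norm (?T x))\<^sup>2 = (\<Sum>i\<in>Basis. (x i)\<^sup>2)"
      unfolding power2_norm_eq_inner by (subst euclidean_inner) (simp add: power2_eq_square)
    then have "exp (- b * (norm (?T x))\<^sup>2) = (\<Prod>i\<in>Basis. exp (- b * (x i)\<^sup>2))"
      by (simp add: sum_distrib_left exp_sum flip: sum_negf)
    moreover have "cis (?T x \<bullet> y) = (\<Prod>i\<in>Basis. cis (x i * (y \<bullet> i)))"
      by (simp add: inner_sum_left cis_sum inner_commute [of y])
    ultimately show ?thesis by (simp add: prod.distrib)
  qed
  have T [measurable]: "?T \<in> (\<Pi>\<^sub>M b\<in>Basis. lborel) \<rightarrow>\<^sub>M borel" by measurable
  have fm [measurable]: "?f \<in> borel_measurable borel"
    by (intro borel_measurable_continuous_onI continuous_intros)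
  have "integrable (\<Pi>\<^sub>M b\<in>Basis. lborel) (\<lambda>x. \<Prod>i\<in>Basis. ?h i (x i))"
    by (intro product_integrable_prod finite_Basis integral_gauss_cis_real b)
  then show ?int
    by (subst lborel_eq) (simp only: integrable_distr_eq [OF T fm] f)
  have "(LINT x|lborel. ?f x) = (LINT x|(\<Pi>\<^sub>M b\<in>Basis. lborel). ?f (?T x))"
    by (subst lborel_eq) (simp only: integral_distr [OF T fm])
  also have "\<dots> = (\<Prod>i\<in>Basis. LINT x|lborel. ?h i x)"
    unfolding f by (intro product_integral_prod finite_Basis integral_gauss_cis_real b)
  also have "\<dots> = (\<Prod>i\<in>Basis. of_real (sqrt (pi / b) * exp (- (y \<bullet> i)\<^sup>2 / (4 * b))))"
    by (simp only: integral_gauss_cis_real(2) [OF b])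
  also have "\<dots> = of_real (sqrt (pi / b) ^ DIM('a) * exp (- (norm y)\<^sup>2 / (4 * b)))"
  proof -
    have "(norm y)\<^sup>2 = (\<Sum>i\<in>Basis. (y \<bullet> i)\<^sup>2)"
      unfolding power2_norm_eq_inner by (subst euclidean_inner) (simp add: power2_eq_square)
    then have "exp (- (norm y)\<^sup>2 / (4 * b)) = (\<Prod>i\<in>Basis. exp (- (y \<bullet> i)\<^sup>2 / (4 * b)))"
      by (simp add: exp_sum [symmetric] sum_divide_distrib sum_negf)
    then show ?thesis by (simp add: prod.distrib)
  qed
  finally show ?eq .
qed

section \<open>Integrable functions with vanishing integrals over boxes or against Gaussians\<close>

lemma integrable_gauss:
  fixes x0 :: "'a::euclidean_space"
  assumes "b > 0"
  shows "integrable lborel (\<lambda>x::'a. exp (- b * (norm x)\<^sup>2))"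
    and "(LINT x|lborel. exp (- b * (norm (x::'a))\<^sup>2)) > 0"
proof -
  have "integrable lborel (\<lambda>x::'a. complex_of_real (exp (- b * (norm x)\<^sup>2)))"
    using integral_gauss_cis(1) [OF assms, of "0::'a"] by simp
  then show "integrable lborel (\<lambda>x::'a. exp (- b * (norm x)\<^sup>2))"
    unfolding complex_of_real_integrable_eq .
  have "complex_of_real (LINT x|lborel. exp (- b * (norm (x::'a))\<^sup>2)) = of_real (sqrt (pi / b) ^ DIM('a))"
    using integral_gauss_cis(2) [OF assms, of "0::'a"] by simp
  then have "(LINT x|lborel. exp (- b * (norm (x::'a))\<^sup>2)) = sqrt (pi / b) ^ DIM('a)"
    unfolding of_real_eq_iff .
  then show "(LINT x|lborel. exp (- b * (norm (x::'a))\<^sup>2)) > 0"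
    using assms by simp
qed

text \<open>The positive and the negative part of \<open>g\<close> are densities of finite measures
  that agree on boxes, an intersection-stable generator of the Borel sets. The measures therefore
  coincide, and a density is unique almost everywhere.\<close>

lemma AE_eq_zero_if_box_integrals_zero:
  fixes g :: "'a::euclidean_space \<Rightarrow> real"
  assumes g: "integrable lborel g" and 0: "\<And>a b. (LINT x|lborel. g x * indicator (box a b) x) = 0"
  shows "AE x in lborel. g x = 0"
proof -
  have gm [measurable]: "g \<in> borel_measurable lborel" using g by auto
  let ?p = "\<lambda>x. max 0 (g x)" and ?n = "\<lambda>x. max 0 (- g x)"
  have p: "integrable lborel ?p" "integrable lborel ?n" using g by auto
  have em: "emeasure (density lborel (\<lambda>x. ennreal (f x))) A = ennreal (LINT x|lborel. f x * indicator A x)"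
    if "integrable lborel f" "\<And>x. 0 \<le> f x" "A \<in> sets lborel" for f :: "'a \<Rightarrow> real" and A
  proof -
    have [measurable]: "f \<in> borel_measurable lborel" "A \<in> sets borel" using that by auto
    have "emeasure (density lborel (\<lambda>x. ennreal (f x))) A = (\<integral>\<^sup>+x. ennreal (f x * indicator A x) \<partial>lborel)"
      using that by (subst emeasure_density) (auto intro!: nn_integral_cong split: split_indicator)
    also have "\<dots> = ennreal (LINT x|lborel. f x * indicator A x)"
      using that by (intro nn_integral_eq_integral integrable_real_mult_indicator) auto
    finally show ?thesis .
  qed
  have "density lborel (\<lambda>x. ennreal (?p x)) = density lborel (\<lambda>x. ennreal (?n x))" (is "?P = ?N")
  proof (rule measure_eqI_generator_eq)
    let ?E = "range (\<lambda>(a, b). box a b::'a set)"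
    show "Int_stable ?E"
      by (auto simp: Int_stable_def box_Int_box)
    show "?E \<subseteq> Pow UNIV" "sets ?P = sigma_sets UNIV ?E" "sets ?N = sigma_sets UNIV ?E"
      by (simp_all add: borel_eq_box)
    let ?A = "\<lambda>n::nat. box (- (real n *\<^sub>R One)) (real n *\<^sub>R One) :: 'a set"
    show "range ?A \<subseteq> ?E" "(\<Union>i. ?A i) = UNIV"
      unfolding UN_box_eq_UNIV by auto
    show "emeasure ?P (?A i) \<noteq> \<infinity>" for i
      by (subst em [OF p(1)]) auto
    show "emeasure ?P X = emeasure ?N X" if "X \<in> ?E" for X
    proof -
      from that obtain a b where X: "X = box a b" by auto
      have "(LINT x|lborel. ?p x * indicator X x) - (LINT x|lborel. ?n x * indicator X x)
          = (LINT x|lborel. ?p x * indicator X x - ?n x * indicator X x)"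
        using p by (intro Bochner_Integration.integral_diff [symmetric] integrable_real_mult_indicator) (auto simp: X)
      also have "\<dots> = (LINT x|lborel. g x * indicator (box a b) x)"
        unfolding X by (intro Bochner_Integration.integral_cong) (auto split: split_indicator)
      finally have "(LINT x|lborel. ?p x * indicator X x) = (LINT x|lborel. ?n x * indicator X x)"
        by (simp add: 0)
      moreover have "X \<in> sets lborel" by (simp add: X)
      ultimately show ?thesis using em [OF p(1)] em [OF p(2)] by (metis (no_types, lifting) max.cobounded1)
    qed
  qed
  then have "AE x in lborel. ennreal (?p x) = ennreal (?n x)"
    by (intro sigma_finite_measure.density_unique) (auto intro: sigma_finite_lborel)
  then show ?thesis
    by eventually_elim (auto simp: max_def split: if_splits)
qed

text \<open>Averaging the centres of the Gaussians over a box, and letting their width tend to 0,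
  yields the integral over the box.\<close>

lemma AE_eq_zero_if_gauss_integrals_zero_real:
  fixes g :: "'a::euclidean_space \<Rightarrow> real"
  assumes g: "integrable lborel g"
    and 0: "\<And>a x0. a > 0 \<Longrightarrow> (LINT x|lborel. g x * exp (- a * (norm (x - x0))\<^sup>2)) = 0"
  shows "AE x in lborel. g x = 0"
proof (rule AE_eq_zero_if_box_integrals_zero [OF g])
  fix l u :: 'a
  let ?B = "indicator (box l u) :: 'a \<Rightarrow> real"
  have gm [measurable]: "g \<in> borel_measurable borel" using g by auto
  define G where "G z = exp (- 1 * (norm z)\<^sup>2)" for z :: 'a
  have G: "integrable lborel G" "(LINT z|lborel. G z) > 0"
    using integrable_gauss [of 1, where 'a='a] by (simp_all add: G_def [abs_def])
  then have Gm [measurable]: "G \<in> borel_measurable borel" by auto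
  have G0: "G z \<ge> 0" for z by (simp add: G_def)
  \<comment> \<open>The indicator of the box convolved with a Gaussian of width \<open>s\<close>,
    written after the substitution y = x + s z so that only the indicator depends on
    \<open>s\<close>.\<close>
  define k where "k s x = (LINT z|lborel. ?B (x + s *\<^sub>R z) * G z)" for s x
  have km [measurable]: "k s \<in> borel_measurable borel" for s
    unfolding k_def by measurable
  \<comment> \<open>Up to the factor \<open>s ^ DIM('a)\<close>, \<open>k s\<close> is a
    superposition of Gaussians with exponent 1 / s^2 centred in the box. Fubini moves the integral
    against \<open>g\<close> inside, where the hypothesis makes it vanish.\<close>
  have kint: "(LINT x|lborel. g x * k s x) = 0" if s: "s > 0" for s
  proof -
    define H where "H y = exp (- (1 / s\<^sup>2) * (norm y)\<^sup>2)" for y :: 'a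
    have [measurable]: "H \<in> borel_measurable borel" unfolding H_def by measurable
    have H: "0 \<le> H y" "H y \<le> 1" for y by (auto simp: H_def)
    have GH: "G z = H (s *\<^sub>R z)" for z using s by (simp add: G_def H_def power_mult_distrib)
    have Hs: "H (- y) = H y" for y by (simp add: H_def)
    have k: "(LINT y|lborel. ?B y * H (x - y)) = s ^ DIM('a) * k s x" for x
    proof -
      have "(LINT y|lborel. ?B y * H (x - y))
          = (LINT y|density (distr lborel borel (\<lambda>z. x + s *\<^sub>R z)) (\<lambda>_. ennreal (\<bar>s\<bar> ^ DIM('a))). ?B y * H (x - y))"
        using s by (subst lborel_affine [of s x]) auto
      also have "\<dots> = (LINT z|lborel. s ^ DIM('a) * (?B (x + s *\<^sub>R z) * H (x - (x + s *\<^sub>R z))))"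
        using s by (simp add: integral_density integral_distr)
      also have "\<dots> = s ^ DIM('a) * k s x"
        using Hs unfolding k_def GH by simp
      finally show ?thesis .
    qed
    have int: "integrable (lborel \<Otimes>\<^sub>M lborel) (\<lambda>(x, y). g x * (?B y * H (x - y)))"
    proof (rule Bochner_Integration.integrable_bound)
      show "integrable (lborel \<Otimes>\<^sub>M lborel) (\<lambda>(x, y). g x * ?B y)"
      proof (rule lborel_pair.Fubini_integrable)
        have "integrable lborel ?B" by (simp add: integrable_indicator_iff emeasure_lborel_box_eq)
        then show "integrable lborel (\<lambda>x. LINT y|lborel. norm (case (x, y) of (x, y) \<Rightarrow> g x * ?B y))"
            "AE x in lborel. integrable lborel (\<lambda>y. case (x, y) of (x, y) \<Rightarrow> g x * ?B y)"
          using g by (auto simp: abs_mult)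
      qed measurable
      show "AE p in lborel \<Otimes>\<^sub>M lborel. norm (case p of (x, y) \<Rightarrow> g x * (?B y * H (x - y)))
          \<le> norm (case p of (x, y) \<Rightarrow> g x * ?B y)"
        using mult_left_mono [OF H(2)] H(1)
        by (intro AE_I2) (fastforce simp: abs_mult split: split_indicator)
    qed measurable
    have "s ^ DIM('a) * (LINT x|lborel. g x * k s x) = (LINT x|lborel. g x * (s ^ DIM('a) * k s x))"
      by (subst integral_mult_right_zero [symmetric]) (simp add: mult.left_commute)
    also have "\<dots> = (LINT x|lborel. LINT y|lborel. g x * (?B y * H (x - y)))"
      by (simp flip: k)
    also have "\<dots> = (LINT y|lborel. LINT x|lborel. g x * (?B y * H (x - y)))"
      by (rule lborel_pair.Fubini_integral [symmetric, OF int])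
    also have "\<dots> = (LINT y|lborel. ?B y * (LINT x|lborel. g x * H (x - y)))"
      by (subst integral_mult_right_zero [symmetric]) (simp add: mult.left_commute)
    also have "\<dots> = 0"
      using 0 [of "1 / s\<^sup>2"] s by (simp add: H_def)
    finally show ?thesis using s by simp
  qed
  \<comment> \<open>Off the boundary, which is a null set, the indicator is locally constant, so the
    mollified indicators converge pointwise.\<close>
  have "AE x in lborel. x \<notin> cbox l u - box l u"
    using negligible_frontier_interval [of l u]
    by (metis AE_completion_iff AE_not_in negligible_iff_null_sets)
  then have klim: "AE x in lborel. (\<lambda>n. k (1 / real (Suc n)) x) \<longlonglongrightarrow> ?B x * (LINT z|lborel. G z)"
  proof eventually_elim
    case (elim x)
    have "(\<lambda>n. LINT z|lborel. ?B (x + (1 / real (Suc n)) *\<^sub>R z) * G z) \<longlonglongrightarrow> (LINT z|lborel. ?B x * G z)"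
    proof (rule integral_dominated_convergence)
      show "AE z in lborel. (\<lambda>n. ?B (x + (1 / real (Suc n)) *\<^sub>R z) * G z) \<longlonglongrightarrow> ?B x * G z"
      proof (intro AE_I2 tendsto_mult tendsto_const)
        fix z :: 'a
        have "(\<lambda>n. x + (1 / real (Suc n)) *\<^sub>R z) \<longlonglongrightarrow> x + 0 *\<^sub>R z"
          by (intro tendsto_intros LIMSEQ_Suc lim_1_over_n)
        then have lim: "(\<lambda>n. x + (1 / real (Suc n)) *\<^sub>R z) \<longlonglongrightarrow> x" by simp
        have "x \<in> box l u \<or> x \<in> - cbox l u" using elim by auto
        then have "\<forall>\<^sub>F n in sequentially. ?B (x + (1 / real (Suc n)) *\<^sub>R z) = ?B x"
        proof
          assume x: "x \<in> box l u"
          with lim have "\<forall>\<^sub>F n in sequentially. x + (1 / real (Suc n)) *\<^sub>R z \<in> box l u"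
            by (intro topological_tendstoD) auto
          then show ?thesis using x by (auto elim!: eventually_mono)
        next
          assume x: "x \<in> - cbox l u"
          with lim have "\<forall>\<^sub>F n in sequentially. x + (1 / real (Suc n)) *\<^sub>R z \<in> - cbox l u"
            by (intro topological_tendstoD) (auto intro: open_Compl)
          moreover have "y \<notin> box l u" if "y \<in> - cbox l u" for y
            using that box_subset_cbox by blast
          ultimately show ?thesis using x by (auto elim!: eventually_mono simp: indicator_def)
        qed
        then show "(\<lambda>n. ?B (x + (1 / real (Suc n)) *\<^sub>R z)) \<longlonglongrightarrow> ?B x"
          by (rule tendsto_eventually)
      qed
      show "AE z in lborel. norm (?B (x + (1 / real (Suc n)) *\<^sub>R z) * G z) \<le> G z" for n
        using G0 by (auto split: split_indicator)
    qed (use G in auto)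
    then show ?case by (simp add: k_def)
  qed
  have kbd: "\<bar>k s x\<bar> \<le> (LINT z|lborel. G z)" for s x
  proof -
    have "\<bar>k s x\<bar> \<le> (LINT z|lborel. norm (?B (x + s *\<^sub>R z) * G z))"
      unfolding k_def using integral_norm_bound by (metis real_norm_def)
    also have "\<dots> \<le> (LINT z|lborel. G z)"
    proof (rule integral_mono)
      show "integrable lborel (\<lambda>z. norm (?B (x + s *\<^sub>R z) * G z))"
        using G0 by (intro Bochner_Integration.integrable_bound [OF G(1)]) (auto split: split_indicator)
    qed (use G G0 in \<open>auto split: split_indicator\<close>)
    finally show ?thesis .
  qed
  have "(\<lambda>n. LINT x|lborel. g x * k (1 / real (Suc n)) x) \<longlonglongrightarrow> (LINT x|lborel. g x * (?B x * (LINT z|lborel. G z)))"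
  proof (rule integral_dominated_convergence)
    show "integrable lborel (\<lambda>x. norm (g x) * (LINT z|lborel. G z))" using g by auto
    show "AE x in lborel. norm (g x * k (1 / real (Suc n)) x) \<le> norm (g x) * (LINT z|lborel. G z)" for n
      using kbd by (auto simp: abs_mult intro!: mult_left_mono)
    show "AE x in lborel. (\<lambda>n. g x * k (1 / real (Suc n)) x) \<longlonglongrightarrow> g x * (?B x * (LINT z|lborel. G z))"
      using klim by eventually_elim (intro tendsto_intros)
  qed measurable
  then have "(LINT x|lborel. (g x * ?B x) * (LINT z|lborel. G z)) = 0"
    using LIMSEQ_unique [OF _ tendsto_const] by (simp add: kint mult.assoc)
  then show "(LINT x|lborel. g x * ?B x) = 0" using G(2) by simp
qed

subsection \<open>Uniqueness of Fourier transforms of tempered functions\<close>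

text \<open>The parameters are inverse squared width, centre and frequency. Centre and frequency are
  both kept because the Fourier transform turns a frequency into a centre.\<close>

definition gauss :: "real \<Rightarrow> 'a::euclidean_space \<Rightarrow> 'a \<Rightarrow> 'a \<Rightarrow> complex" where
  "gauss a x0 q x = of_real (exp (- a * (norm (x - x0))\<^sup>2)) * cis (x \<bullet> q)"

text \<open>Every iterated derivative of a Gaussian is a Gaussian times a function of this class.\<close>

inductive cpoly :: "('a::euclidean_space \<Rightarrow> complex) \<Rightarrow> bool" where
  const: "cpoly (\<lambda>x. c)"
| inner: "cpoly (\<lambda>x. of_real (x \<bullet> b))"
| add: "cpoly P \<Longrightarrow> cpoly Q \<Longrightarrow> cpoly (\<lambda>x. P x + Q x)"
| mult: "cpoly P \<Longrightarrow> cpoly Q \<Longrightarrow> cpoly (\<lambda>x. P x * Q x)"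

section \<open>Gaussians are Schwartz functions\<close>

lemma cpoly_has_derivative:
  assumes "cpoly P"
  shows "\<exists>D. (\<forall>x. (P has_derivative D x) (at x)) \<and> (\<forall>b. cpoly (\<lambda>x. D x b))"
  using assms
proof induction
  case (const c)
  show ?case by (rule exI [of _ "\<lambda>_ _. 0"]) (auto intro: cpoly.intros)
next
  case (inner b)
  show ?case
    by (rule exI [of _ "\<lambda>_ h. of_real (h \<bullet> b)"]) (auto intro!: cpoly.intros derivative_eq_intros)
next
  case (add P Q)
  then obtain D E where "\<And>x. (P has_derivative D x) (at x)" "\<And>b. cpoly (\<lambda>x. D x b)"
    "\<And>x. (Q has_derivative E x) (at x)" "\<And>b. cpoly (\<lambda>x. E x b)" by blast
  then show ?case
    by (intro exI [of _ "\<lambda>x h. D x h + E x h"]) (auto intro!: cpoly.intros has_derivative_add)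
next
  case (mult P Q)
  then obtain D E where "\<And>x. (P has_derivative D x) (at x)" "\<And>b. cpoly (\<lambda>x. D x b)"
    "\<And>x. (Q has_derivative E x) (at x)" "\<And>b. cpoly (\<lambda>x. E x b)" by blast
  with mult show ?case
    by (intro exI [of _ "\<lambda>x h. P x * E x h + D x h * Q x"]) (auto intro!: cpoly.intros has_derivative_mult)
qed

lemma cpoly_growth:
  assumes "cpoly P"
  shows "\<exists>C k. 0 \<le> C \<and> (\<forall>x. norm (P x) \<le> C * (1 + norm x) ^ k)"
  using assms
proof induction
  case (const c)
  show ?case by (rule exI [of _ "norm c"], rule exI [of _ 0]) auto
next
  case (inner b)
  have "\<bar>x \<bullet> b\<bar> \<le> norm b * (1 + norm x) ^ 1" for x
  proof -
    have "\<bar>x \<bullet> b\<bar> \<le> norm x * norm b" by (rule Cauchy_Schwarz_ineq2)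
    then have "\<bar>x \<bullet> b\<bar> \<le> norm b * norm x" by (simp only: mult.commute)
    with norm_ge_zero [of b] show ?thesis unfolding power_one_right distrib_left by linarith
  qed
  then show ?case by (intro exI [of _ "norm b"] exI [of _ 1]) auto
next
  case (add P Q)
  then obtain C k D l where CD: "0 \<le> C" "\<And>x. norm (P x) \<le> C * (1 + norm x) ^ k"
    "0 \<le> D" "\<And>x. norm (Q x) \<le> D * (1 + norm x) ^ l" by blast
  have "norm (P x + Q x) \<le> (C + D) * (1 + norm x) ^ (k + l)" for x
  proof -
    have "norm (P x + Q x) \<le> C * (1 + norm x) ^ k + D * (1 + norm x) ^ l"
      using CD(2,4) [of x] norm_triangle_ineq [of "P x" "Q x"] by linarith
    also have "\<dots> \<le> C * (1 + norm x) ^ (k + l) + D * (1 + norm x) ^ (k + l)"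
      using CD by (intro add_mono mult_left_mono power_increasing) auto
    finally show ?thesis by (simp add: algebra_simps)
  qed
  with CD show ?case by (intro exI [of _ "C + D"] exI [of _ "k + l"]) auto
next
  case (mult P Q)
  then obtain C k D l where CD: "0 \<le> C" "\<And>x. norm (P x) \<le> C * (1 + norm x) ^ k"
    "0 \<le> D" "\<And>x. norm (Q x) \<le> D * (1 + norm x) ^ l" by blast
  have "norm (P x * Q x) \<le> (C * D) * (1 + norm x) ^ (k + l)" for x
  proof -
    have "norm (P x * Q x) \<le> (C * (1 + norm x) ^ k) * (D * (1 + norm x) ^ l)"
      unfolding norm_mult using CD by (intro mult_mono) auto
    then show ?thesis by (simp add: power_add mult_ac)
  qed
  with CD show ?case by (intro exI [of _ "C * D"] exI [of _ "k + l"]) auto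
qed

text \<open>For \<open>x0 = 0\<close> this is decay in the single variable r = |x|; the general case
  follows from 1 + |x| \<le> (1 + |x0|) (1 + |x - x0|).\<close>

lemma power_gauss_bounded:
  fixes x0 :: "'a::euclidean_space"
  assumes "a > 0"
  shows "\<exists>C\<ge>0. \<forall>x. (1 + norm x) ^ k * exp (- a * (norm (x - x0))\<^sup>2) \<le> C"
proof -
  have "((\<lambda>r. (1 + r) ^ k * exp (- a * r\<^sup>2)) \<longlongrightarrow> 0) at_top"
    using assms by real_asymp
  then have "\<forall>\<^sub>F r in at_top. (1 + r) ^ k * exp (- a * r\<^sup>2) < 1"
    by (rule order_tendstoD) simp
  then obtain R where R: "\<And>r. r \<ge> R \<Longrightarrow> (1 + r) ^ k * exp (- a * r\<^sup>2) < 1"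
    by (auto simp: eventually_at_top_linorder)
  have *: "(1 + r) ^ k * exp (- a * r\<^sup>2) \<le> max 1 ((1 + \<bar>R\<bar>) ^ k)" if "r \<ge> 0" for r
  proof (cases "r \<ge> R")
    case False
    have "(1 + r) ^ k * exp (- a * r\<^sup>2) \<le> (1 + \<bar>R\<bar>) ^ k * 1"
      using that False assms by (intro mult_mono power_mono) auto
    then show ?thesis by simp
  next
    case True
    show ?thesis by (rule order_trans [OF less_imp_le [OF R [OF True]] max.cobounded1])
  qed
  have "(1 + norm x) ^ k * exp (- a * (norm (x - x0))\<^sup>2) \<le> (1 + norm x0) ^ k * max 1 ((1 + \<bar>R\<bar>) ^ k)" for x
  proof -
    have "1 + norm x \<le> (1 + norm x0) * (1 + norm (x - x0))"
    proof -
      have "norm x \<le> norm x0 + norm (x - x0)" using norm_triangle_ineq [of x0 "x - x0"] by simp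
      moreover have "0 \<le> norm x0 * norm (x - x0)" by simp
      ultimately show ?thesis unfolding distrib_left distrib_right by linarith
    qed
    then have "(1 + norm x) ^ k * exp (- a * (norm (x - x0))\<^sup>2)
        \<le> ((1 + norm x0) * (1 + norm (x - x0))) ^ k * exp (- a * (norm (x - x0))\<^sup>2)"
      by (intro mult_right_mono power_mono) auto
    also have "\<dots> = (1 + norm x0) ^ k * ((1 + norm (x - x0)) ^ k * exp (- a * (norm (x - x0))\<^sup>2))"
      by (simp add: power_mult_distrib)
    also have "\<dots> \<le> (1 + norm x0) ^ k * max 1 ((1 + \<bar>R\<bar>) ^ k)"
      by (intro mult_left_mono *) auto
    finally show ?thesis .
  qed
  then show ?thesis by (intro exI [of _ "(1 + norm x0) ^ k * max 1 ((1 + \<bar>R\<bar>) ^ k)"]) auto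
qed

lemma norm_gauss: "norm (gauss a x0 q x) = exp (- a * (norm (x - x0))\<^sup>2)"
  by (simp add: gauss_def norm_mult)

lemma gauss_has_derivative:
  "(gauss a x0 q has_derivative
    (\<lambda>h. (of_real (- 2 * a * ((x - x0) \<bullet> h)) + \<i> * of_real (h \<bullet> q)) * gauss a x0 q x)) (at x)"
proof -
  have g: "gauss a x0 q x = exp (of_real (- a * ((x - x0) \<bullet> (x - x0))) + \<i> * of_real (x \<bullet> q))" for x
    by (simp only: gauss_def power2_norm_eq_inner cis_conv_exp exp_add exp_of_real)
  have "((\<lambda>x. of_real (- a * ((x - x0) \<bullet> (x - x0))) + \<i> * of_real (x \<bullet> q)) has_derivative
      (\<lambda>h. of_real (- 2 * a * ((x - x0) \<bullet> h)) + \<i> * of_real (h \<bullet> q) :: complex)) (at x)"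
    by (rule derivative_eq_intros refl)+ (auto simp: inner_commute algebra_simps)
  from has_derivative_compose [OF this, OF DERIV_exp [unfolded has_field_derivative_def]] show ?thesis
    unfolding g [abs_def] by (simp only: mult.commute)
qed

lemma schwartz_gauss:
  fixes x0 :: "'a::euclidean_space"
  assumes "a > 0"
  shows "schwartz (gauss a x0 q)"
proof -
  have *: "\<exists>P. cpoly P \<and> foldr (\<lambda>b f x. frechet_derivative f (at x) b) \<alpha> (gauss a x0 q)
      = (\<lambda>x. P x * gauss a x0 q x)" for \<alpha> :: "'a list"
  proof (induction \<alpha>)
    case Nil
    show ?case by (intro exI [of _ "\<lambda>_. 1"]) (auto intro: cpoly.intros)
  next
    case (Cons b \<alpha>)
    then obtain P where P: "cpoly P"
      "foldr (\<lambda>b f x. frechet_derivative f (at x) b) \<alpha> (gauss a x0 q) = (\<lambda>x. P x * gauss a x0 q x)"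
      by blast
    obtain D where D: "\<And>x. (P has_derivative D x) (at x)" "\<And>b. cpoly (\<lambda>x. D x b)"
      using cpoly_has_derivative [OF P(1)] by blast
    \<comment> \<open>Product rule: \<open>P\<close> times the derivative of the exponent in
      direction \<open>b\<close>, plus the derivative of \<open>P\<close>. The difference
      \<open>x - x0\<close> is spelled out as a sum to fit the constructors of
      \<open>cpoly\<close>.\<close>
    define Q where "Q x = P x * (of_real (- 2 * a) * (of_real (x \<bullet> b) + - of_real (x0 \<bullet> b)) + \<i> * of_real (b \<bullet> q)) + D x b" for x
    have "cpoly Q" unfolding Q_def by (intro cpoly.intros P D)
    moreover have "frechet_derivative (\<lambda>x. P x * gauss a x0 q x) (at x) b = Q x * gauss a x0 q x" for x
    proof -
      have "((\<lambda>x. P x * gauss a x0 q x) has_derivative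
        (\<lambda>h. P x * ((of_real (- 2 * a * ((x - x0) \<bullet> h)) + \<i> * of_real (h \<bullet> q)) * gauss a x0 q x)
          + D x h * gauss a x0 q x)) (at x)"
        by (rule has_derivative_mult [OF D(1) gauss_has_derivative])
      from frechet_derivative_at [OF this, symmetric] show ?thesis
        by (simp add: Q_def algebra_simps)
    qed
    ultimately show ?case using P(2) by (intro exI [of _ Q]) auto
  qed
  have diff: "(\<lambda>x. P x * gauss a x0 q x) differentiable (at x)" if P: "cpoly P" for P x
  proof -
    obtain D where "\<And>x. (P has_derivative D x) (at x)"
      using cpoly_has_derivative [OF P] by blast
    from has_derivative_mult [OF this gauss_has_derivative [of a x0 q x]] show ?thesis
      by (rule differentiableI)
  qed
  have bdd: "bounded (range (\<lambda>x. norm x ^ k *\<^sub>R (P x * gauss a x0 q x)))" if P: "cpoly P" for P k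
  proof -
    obtain C m where C: "0 \<le> C" "\<And>x. norm (P x) \<le> C * (1 + norm x) ^ m"
      using cpoly_growth [OF P] by blast
    obtain B where B: "0 \<le> B" "\<And>x. (1 + norm x) ^ (k + m) * exp (- a * (norm (x - x0))\<^sup>2) \<le> B"
      using power_gauss_bounded [OF assms, of "k + m" x0] by blast
    have "norm (norm x ^ k *\<^sub>R (P x * gauss a x0 q x)) \<le> C * B" for x
    proof -
      have "norm (norm x ^ k *\<^sub>R (P x * gauss a x0 q x))
          \<le> (1 + norm x) ^ k * ((C * (1 + norm x) ^ m) * exp (- a * (norm (x - x0))\<^sup>2))"
        unfolding norm_scaleR norm_mult norm_gauss using C
        by (intro mult_mono) (auto intro!: power_mono)
      also have "\<dots> = C * ((1 + norm x) ^ (k + m) * exp (- a * (norm (x - x0))\<^sup>2))"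
        by (simp add: power_add mult_ac)
      also have "\<dots> \<le> C * B" using B C by (intro mult_left_mono)
      finally show ?thesis .
    qed
    then show ?thesis by (auto simp: bounded_iff)
  qed
  show ?thesis
    unfolding schwartz_def Let_def
  proof (intro allI impI)
    fix \<alpha> :: "'a list"
    obtain P where P: "cpoly P"
      "foldr (\<lambda>b f x. frechet_derivative f (at x) b) \<alpha> (gauss a x0 q) = (\<lambda>x. P x * gauss a x0 q x)"
      using * by blast
    show "(\<forall>x. foldr (\<lambda>b f x. frechet_derivative f (at x) b) \<alpha> (gauss a x0 q) differentiable (at x)) \<and>
      (\<forall>k. bounded (range (\<lambda>x. norm x ^ k *\<^sub>R foldr (\<lambda>b f x. frechet_derivative f (at x) b) \<alpha> (gauss a x0 q) x)))"
      unfolding P(2) using diff bdd P(1) by blast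
  qed
qed

text \<open>The modulation merges with the Fourier character into the phase \<xi> . (q - x), so this
  is the Gaussian integral evaluated at q - x.\<close>

lemma fourier_gauss:
  fixes q :: "'a::euclidean_space"
  assumes b: "b > 0"
  shows "fourier (gauss b 0 q) x = of_real (sqrt (pi / b) ^ DIM('a)) * gauss (1 / (4 * b)) q 0 x"
proof -
  have "cis (- (\<xi> \<bullet> x)) * gauss b 0 q \<xi> = of_real (exp (- b * (norm \<xi>)\<^sup>2)) * cis (\<xi> \<bullet> (q - x))" for \<xi>
    by (simp add: gauss_def mult.left_commute cis_mult inner_diff_right)
  then show ?thesis
    unfolding fourier_def
    by (simp only: integral_gauss_cis(2) [OF b]) (simp add: gauss_def norm_minus_commute)
qed

lemma gauss_measurable [measurable]: "gauss a x0 q \<in> borel_measurable borel"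
proof (intro borel_measurable_continuous_onI)
  show "continuous_on UNIV (gauss a x0 q)"
    unfolding gauss_def by (intro continuous_intros)
qed

text \<open>The polynomial weight from \<open>tempered\<close> is absorbed by the Gaussian, leaving
  an integrable function times a bounded one.\<close>

lemma integrable_tempered_gauss:
  fixes f :: "'a::euclidean_space \<Rightarrow> complex"
  assumes f: "tempered f" and a: "a > 0"
  shows "integrable lebesgue (\<lambda>x. f x * gauss a x0 q x)"
proof -
  obtain k where k: "integrable lebesgue (\<lambda>x. f x / of_real ((1 + norm x) ^ k))"
    using f by (auto simp: tempered_def)
  obtain B where B: "0 \<le> B" "\<And>x. (1 + norm x) ^ k * exp (- a * (norm (x - x0))\<^sup>2) \<le> B"
    using power_gauss_bounded [OF a, of k x0] by blast
  have pos: "1 + norm x \<noteq> 0" for x :: 'a using norm_ge_zero [of x] by linarith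
  have eq: "f x * gauss a x0 q x = (f x / of_real ((1 + norm x) ^ k)) * (of_real ((1 + norm x) ^ k) * gauss a x0 q x)" for x
  proof -
    have "complex_of_real ((1 + norm x) ^ k) \<noteq> 0" using pos [of x] by (simp only: of_real_eq_0_iff) simp
    moreover have "u * v = (u / w) * (w * v)" if "w \<noteq> 0" for u v w :: complex
      using that by simp
    ultimately show ?thesis by blast
  qed
  have [measurable]: "(\<lambda>x. f x / of_real ((1 + norm x) ^ k)) \<in> borel_measurable lebesgue"
    using k by auto
  have [measurable]: "(\<lambda>x. of_real ((1 + norm x) ^ k) * gauss a x0 q x) \<in> borel_measurable lebesgue"
    by (intro measurable_completion) measurable
  show ?thesis
  proof (rule Bochner_Integration.integrable_bound)
    show "integrable lebesgue (\<lambda>x. B * norm (f x / of_real ((1 + norm x) ^ k)))" using k by auto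
    show "(\<lambda>x. f x * gauss a x0 q x) \<in> borel_measurable lebesgue" unfolding eq by measurable
    show "AE x in lebesgue. norm (f x * gauss a x0 q x) \<le> norm (B * norm (f x / of_real ((1 + norm x) ^ k)))"
    proof (rule AE_I2)
      fix x
      have "norm (of_real ((1 + norm x) ^ k) * gauss a x0 q x) \<le> B"
        using B(2) [of x] by (simp add: norm_mult norm_power norm_gauss del: of_real_power)
      then have "norm (f x * gauss a x0 q x) \<le> norm (f x / of_real ((1 + norm x) ^ k)) * B"
        unfolding eq norm_mult by (intro mult_left_mono) auto
      then show "norm (f x * gauss a x0 q x) \<le> norm (B * norm (f x / of_real ((1 + norm x) ^ k)))"
        using B(1) by (simp add: abs_mult mult.commute)
    qed
  qed
qed

text \<open>Supplies Borel representatives: Fubini arguments and measurability of slices work for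
  these, while the functions in the statement are only Lebesgue measurable.\<close>

lemma completion_ex_borel_measurable_complex:
  fixes f :: "'a \<Rightarrow> complex"
  assumes [measurable]: "f \<in> borel_measurable (completion M)"
  shows "\<exists>f'\<in>borel_measurable M. AE x in M. f x = f' x"
proof -
  obtain r where r: "r \<in> borel_measurable M" "AE x in M. Re (f x) = r x"
    using completion_ex_borel_measurable_real [of "\<lambda>x. Re (f x)" M] by auto
  obtain s where s: "s \<in> borel_measurable M" "AE x in M. Im (f x) = s x"
    using completion_ex_borel_measurable_real [of "\<lambda>x. Im (f x)" M] by auto
  have "AE x in M. f x = Complex (r x) (s x)"
    using r(2) s(2) by eventually_elim (simp add: complex_eq_iff)
  moreover have "(\<lambda>x. Complex (r x) (s x)) \<in> borel_measurable M"
    using r(1) s(1) by (simp add: borel_measurable_complex_iff)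
  ultimately show ?thesis by (rule bexI)
qed

text \<open>Multiplying \<open>f\<close> by a fixed Gaussian makes it integrable, and keeps the hypothesis since
  Gaussians are closed under products.\<close>

lemma AE_eq_zero_if_gauss_integrals_zero:
  fixes f :: "'a::euclidean_space \<Rightarrow> complex"
  assumes f: "tempered f"
    and 0: "\<And>a x0. a > 0 \<Longrightarrow> (LINT x|lebesgue. f x * gauss a x0 0 x) = 0"
  shows "AE x in lborel. f x = 0"
proof -
  let ?g = "\<lambda>x. f x * gauss 1 0 0 x"
  have gi: "integrable lebesgue ?g"
    by (rule integrable_tempered_gauss [OF f]) simp
  then obtain g where gm [measurable]: "g \<in> borel_measurable lborel" and g: "AE x in lborel. ?g x = g x"
    using completion_ex_borel_measurable_complex [of ?g lborel] by auto
  have g': "AE x in lebesgue. ?g x = g x"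
    using g by (rule AE_completion)
  have gm' [measurable]: "g \<in> borel_measurable lebesgue" using gm by (rule measurable_completion)
  have "integrable lebesgue g"
    by (rule Bochner_Integration.integrable_cong_AE_imp [OF gi gm']) (use g' in auto)
  then have gint: "integrable lborel g"
    by (subst (asm) integrable_completion) auto
  have zero: "(LINT x|lborel. g x * of_real (exp (- a * (norm (x - x0))\<^sup>2))) = 0" if a: "a > 0" for a x0
  proof -
    \<comment> \<open>Completing the square: \<open>x1\<close> and \<open>c\<close> are the centre
      and the constant for which exp(-|x|^2) exp(-a |x - x0|^2) = exp(c) exp(-(a+1) |x -
      x1|^2).\<close>
    define x1 where "x1 = (a / (a + 1)) *\<^sub>R x0"
    define c where "c = (a + 1) * (norm x1)\<^sup>2 - a * (norm x0)\<^sup>2"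
    have sq: "- 1 * (norm x)\<^sup>2 + - a * (norm (x - x0))\<^sup>2 = c + - (a + 1) * (norm (x - x1))\<^sup>2" for x
    proof -
      have "(a + 1) *\<^sub>R x1 = a *\<^sub>R x0" using a by (simp add: x1_def)
      then have "(a + 1) * (x \<bullet> x1) = a * (x \<bullet> x0)"
        by (metis inner_scaleR_right)
      then show ?thesis
        by (simp add: c_def power2_norm_eq_inner inner_diff_left inner_diff_right inner_commute algebra_simps)
    qed
    then have e: "?g x * of_real (exp (- a * (norm (x - x0))\<^sup>2)) = of_real (exp c) * (f x * gauss (a + 1) x1 0 x)" for x
    proof -
      have E: "of_real (exp (- 1 * (norm x)\<^sup>2)) * of_real (exp (- a * (norm (x - x0))\<^sup>2))
          = of_real (exp c) * complex_of_real (exp (- (a + 1) * (norm (x - x1))\<^sup>2))"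
        by (simp only: of_real_mult [symmetric] exp_add [symmetric] sq)
      have "?g x * of_real (exp (- a * (norm (x - x0))\<^sup>2))
          = f x * (of_real (exp (- 1 * (norm x)\<^sup>2)) * of_real (exp (- a * (norm (x - x0))\<^sup>2)))"
        by (simp only: gauss_def diff_zero inner_zero_right cis_zero mult_1_right mult.assoc)
      also have "\<dots> = of_real (exp c) * (f x * gauss (a + 1) x1 0 x)"
        unfolding E by (simp only: gauss_def inner_zero_right cis_zero mult_1_right mult.left_commute)
      finally show ?thesis .
    qed
    have [measurable]: "(\<lambda>x. g x * of_real (exp (- a * (norm (x - x0))\<^sup>2))) \<in> borel_measurable lborel"
      by measurable
    have "(LINT x|lborel. g x * of_real (exp (- a * (norm (x - x0))\<^sup>2)))
        = (LINT x|lebesgue. g x * of_real (exp (- a * (norm (x - x0))\<^sup>2)))"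
      by (rule integral_completion [symmetric]) measurable
    also have "\<dots> = (LINT x|lebesgue. of_real (exp c) * (f x * gauss (a + 1) x1 0 x))"
    proof (rule Bochner_Integration.integral_cong_AE)
      show "(\<lambda>x. g x * of_real (exp (- a * (norm (x - x0))\<^sup>2))) \<in> borel_measurable lebesgue"
        by (rule measurable_completion) measurable
      show "(\<lambda>x. of_real (exp c) * (f x * gauss (a + 1) x1 0 x)) \<in> borel_measurable lebesgue"
        using integrable_tempered_gauss [OF f, of "a + 1" x1 0] a by auto
      show "AE x in lebesgue. g x * of_real (exp (- a * (norm (x - x0))\<^sup>2)) = of_real (exp c) * (f x * gauss (a + 1) x1 0 x)"
        using g' by eventually_elim (simp only: e [symmetric])
    qed
    also have "\<dots> = 0" using 0 a by simp
    finally show ?thesis .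
  qed
  have i: "integrable lborel (\<lambda>x. g x * of_real (exp (- a * (norm (x - x0))\<^sup>2)))" if a: "a > 0" for a x0
    by (rule Bochner_Integration.integrable_bound [OF gint])
       (use a in \<open>auto simp: norm_mult mult_left_le\<close>)
  have "AE x in lborel. Re (g x) = 0"
  proof (rule AE_eq_zero_if_gauss_integrals_zero_real)
    show "(LINT x|lborel. Re (g x) * exp (- a * (norm (x - x0))\<^sup>2)) = 0" if a: "a > 0" for a x0
      using integral_Re [OF i [OF a, of x0]] zero [OF a, of x0] by simp
  qed (use gint in auto)
  moreover have "AE x in lborel. Im (g x) = 0"
  proof (rule AE_eq_zero_if_gauss_integrals_zero_real)
    show "(LINT x|lborel. Im (g x) * exp (- a * (norm (x - x0))\<^sup>2)) = 0" if a: "a > 0" for a x0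
      using integral_Im [OF i [OF a, of x0]] zero [OF a, of x0] by simp
  qed (use gint in auto)
  ultimately show ?thesis
    using g
  proof eventually_elim
    case (elim x)
    then have "?g x = 0" by (simp add: complex_eq_iff)
    then show ?case by (auto simp: gauss_def)
  qed
qed

section \<open>Linear combinations of tempered functions\<close>

lemma tempered_increase:
  assumes k: "integrable lebesgue (\<lambda>x. f x / complex_of_real ((1 + norm x) ^ k))" and "k \<le> m"
  shows "integrable lebesgue (\<lambda>x::'a::euclidean_space. f x / of_real ((1 + norm x) ^ m))"
proof -
  have pos: "1 + norm x > 0" for x :: 'a using norm_ge_zero [of x] by linarith
  have eq: "f x / of_real ((1 + norm x) ^ m) = (f x / of_real ((1 + norm x) ^ k)) * of_real (1 / (1 + norm x) ^ (m - k))" for x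
  proof -
    have "(1 + norm x) ^ m = (1 + norm x) ^ k * (1 + norm x) ^ (m - k)"
      using assms(2) by (simp flip: power_add)
    then show ?thesis by (simp only: of_real_mult of_real_divide of_real_1) simp
  qed
  have [measurable]: "(\<lambda>x. f x / of_real ((1 + norm x) ^ k)) \<in> borel_measurable lebesgue"
    using k by auto
  have [measurable]: "(\<lambda>x::'a. complex_of_real (1 / (1 + norm x) ^ (m - k))) \<in> borel_measurable lebesgue"
    by (intro measurable_completion) measurable
  show ?thesis
    unfolding eq
  proof (rule Bochner_Integration.integrable_bound [OF k])
    show "AE x in lebesgue. norm ((f x / of_real ((1 + norm x) ^ k)) * of_real (1 / (1 + norm x) ^ (m - k)))
        \<le> norm (f x / of_real ((1 + norm x) ^ k))"
    proof (rule AE_I2)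
      fix x :: 'a
      have "1 \<le> (1 + norm x) ^ (m - k)" by (simp add: one_le_power)
      then have "norm (complex_of_real (1 / (1 + norm x) ^ (m - k))) \<le> 1"
        using pos [of x] by (simp del: of_real_divide of_real_power of_real_add)
      then show "norm ((f x / of_real ((1 + norm x) ^ k)) * of_real (1 / (1 + norm x) ^ (m - k)))
        \<le> norm (f x / of_real ((1 + norm x) ^ k))"
        unfolding norm_mult by (intro mult_left_le) auto
    qed
  qed measurable
qed

lemma tempered_add:
  assumes "tempered f" "tempered g"
  shows "tempered (\<lambda>x. f x + g x)"
proof -
  obtain k l where "integrable lebesgue (\<lambda>x. f x / complex_of_real ((1 + norm x) ^ k))"
    "integrable lebesgue (\<lambda>x. g x / complex_of_real ((1 + norm x) ^ l))"
    using assms by (auto simp: tempered_def)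
  then have "integrable lebesgue (\<lambda>x. f x / complex_of_real ((1 + norm x) ^ max k l))"
    "integrable lebesgue (\<lambda>x. g x / complex_of_real ((1 + norm x) ^ max k l))"
    by (blast intro: tempered_increase max.cobounded1 max.cobounded2)+
  then have "integrable lebesgue (\<lambda>x. (f x + g x) / complex_of_real ((1 + norm x) ^ max k l))"
    unfolding add_divide_distrib by (rule Bochner_Integration.integrable_add)
  then show ?thesis unfolding tempered_def by blast
qed

lemma tempered_uminus: "tempered f \<Longrightarrow> tempered (\<lambda>x. - f x)"
  unfolding tempered_def by auto

lemma tempered_zero: "tempered (\<lambda>x. 0)"
  unfolding tempered_def by auto

lemma tempered_diff: "tempered f \<Longrightarrow> tempered g \<Longrightarrow> tempered (\<lambda>x. f x - g x)"
  using tempered_add [OF _ tempered_uminus, of f g] by simp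

lemma tempered_sum:
  assumes "finite A" "\<And>i. i \<in> A \<Longrightarrow> tempered (f i)"
  shows "tempered (\<lambda>x. \<Sum>i\<in>A. f i x)"
  using assms by (induction A rule: finite_induct) (auto intro: tempered_zero tempered_add)

section \<open>Injectivity of the Fourier transform in both directions\<close>

lemma AE_eq_if_gauss_integrals_eq:
  fixes f g :: "'a::euclidean_space \<Rightarrow> complex"
  assumes f: "tempered f" and g: "tempered g"
    and eq: "\<And>a x0. a > 0 \<Longrightarrow> (LINT x|lebesgue. f x * gauss a x0 0 x) = (LINT x|lebesgue. g x * gauss a x0 0 x)"
  shows "AE x in lborel. f x = g x"
proof -
  have "AE x in lborel. f x - g x = 0"
  proof (rule AE_eq_zero_if_gauss_integrals_zero)
    show "tempered (\<lambda>x. f x - g x)" using f g by (rule tempered_diff)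
    fix a :: real and x0 :: 'a assume "a > 0"
    then show "(LINT x|lebesgue. (f x - g x) * gauss a x0 0 x) = 0"
      by (simp add: left_diff_distrib integrable_tempered_gauss f g eq)
  qed
  then show ?thesis by simp
qed

text \<open>Tested on the same Schwartz function, both transforms give the same pairing with
  \<open>f\<close>, and Gaussians are enough test functions.\<close>

lemma fourier_transform_unique:
  fixes f :: "'a::euclidean_space \<Rightarrow> complex"
  assumes "has_fourier_transform f F" "has_fourier_transform f G"
  shows "AE x in lborel. F x = G x"
proof (rule AE_eq_if_gauss_integrals_eq)
  show "(LINT x|lebesgue. F x * gauss a x0 0 x) = (LINT x|lebesgue. G x * gauss a x0 0 x)"
    if "a > 0" for a x0
    using assms schwartz_gauss [OF that, of x0 0] unfolding has_fourier_transform_def by metis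
qed (use assms in \<open>auto simp: has_fourier_transform_def\<close>)

text \<open>The Gaussian centred at \<open>x0\<close> is a multiple of the transform of a Gaussian
  with frequency \<open>x0\<close>, so the duality that defines the transform expresses its pairing
  with \<open>f\<close> through \<open>F\<close>. This takes the place of Fourier inversion.\<close>

lemma has_fourier_transform_gauss:
  fixes f :: "'a::euclidean_space \<Rightarrow> complex"
  assumes "has_fourier_transform f F" and a: "a > 0"
  shows "(LINT x|lebesgue. f x * gauss a x0 0 x)
    = (LINT \<xi>|lebesgue. F \<xi> * gauss (1 / (4 * a)) 0 x0 \<xi>) / of_real (sqrt (pi * (4 * a)) ^ DIM('a))"
proof -
  \<comment> \<open>Chosen so that 1 / (4 b) = a, the exponent produced by
    \<open>fourier_gauss\<close>.\<close>
  define b where "b = 1 / (4 * a)"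
  have b: "b > 0" "1 / (4 * b) = a" "pi / b = pi * (4 * a)" using a by (auto simp: b_def)
  have "(LINT x|lebesgue. f x * fourier (gauss b 0 x0) x) = (LINT \<xi>|lebesgue. F \<xi> * gauss b 0 x0 \<xi>)"
    using assms(1) schwartz_gauss [OF b(1)] by (auto simp: has_fourier_transform_def)
  then have "of_real (sqrt (pi * (4 * a)) ^ DIM('a)) * (LINT x|lebesgue. f x * gauss a x0 0 x)
      = (LINT \<xi>|lebesgue. F \<xi> * gauss b 0 x0 \<xi>)"
    unfolding fourier_gauss [OF b(1)] b(2,3) by (simp only: mult.left_commute [of "f _"] integral_mult_right_zero)
  moreover have "complex_of_real (sqrt (pi * (4 * a)) ^ DIM('a)) \<noteq> 0"
    using a by simp
  ultimately show ?thesis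
    unfolding b_def by (simp add: field_simps del: of_real_power)
qed

lemma inverse_fourier_transform_unique:
  fixes f :: "'a::euclidean_space \<Rightarrow> complex"
  assumes fF: "has_fourier_transform f F" and gG: "has_fourier_transform g G"
    and FG: "AE x in lborel. F x = G x"
  shows "AE x in lborel. f x = g x"
proof (rule AE_eq_if_gauss_integrals_eq)
  fix a :: real and x0 :: 'a assume a: "a > 0"
  have "(LINT \<xi>|lebesgue. F \<xi> * gauss (1 / (4 * a)) 0 x0 \<xi>) = (LINT \<xi>|lebesgue. G \<xi> * gauss (1 / (4 * a)) 0 x0 \<xi>)"
  proof (rule Bochner_Integration.integral_cong_AE)
    show "AE x in lebesgue. F x * gauss (1 / (4 * a)) 0 x0 x = G x * gauss (1 / (4 * a)) 0 x0 x"
      using AE_completion [OF FG] by eventually_elim simp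
  qed (use fF gG a in \<open>auto simp: has_fourier_transform_def intro!: borel_measurable_integrable integrable_tempered_gauss\<close>)
  then show "(LINT x|lebesgue. f x * gauss a x0 0 x) = (LINT x|lebesgue. g x * gauss a x0 0 x)"
    by (simp add: has_fourier_transform_gauss [OF fF a] has_fourier_transform_gauss [OF gG a])
qed (use fF gG in \<open>auto simp: has_fourier_transform_def\<close>)

subsection \<open>Slicing by hyperplanes\<close>

lemma Basis_vec_eq: "(Basis :: (real^'n) set) = (\<lambda>i. axis i 1) ` UNIV"
  by (auto simp: Basis_vec_def)

lemma hyperplane_point_measurable [measurable (raw)]:
  fixes l :: "'n::finite"
  assumes f: "f \<in> borel_measurable M" and g: "g \<in> M \<rightarrow>\<^sub>M Pi\<^sub>M (UNIV - {l}) (\<lambda>_. borel)"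
  shows "(\<lambda>p. hyperplane_point l (f p) (g p)) \<in> borel_measurable M"
proof (subst borel_measurable_euclidean_space, rule ballI)
  fix b :: "real^'n" assume "b \<in> Basis"
  then obtain i where b: "b = axis i 1" by (auto simp: Basis_vec_eq)
  show "(\<lambda>p. hyperplane_point l (f p) (g p) \<bullet> b) \<in> borel_measurable M"
  proof (cases "i = l")
    case True
    then show ?thesis using f by (simp add: b inner_axis hyperplane_point_def)
  next
    case False
    then have "(\<lambda>y. y i) \<in> Pi\<^sub>M (UNIV - {l}) (\<lambda>_. borel) \<rightarrow>\<^sub>M (borel :: real measure)"
      by (intro measurable_component_singleton) auto
    from measurable_compose [OF g this] False show ?thesis
      by (simp add: b inner_axis hyperplane_point_def)
  qed
qed

lemma sigma_finite_PiM_lborel: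
  fixes I :: "'i set"
  assumes "finite I"
  shows "sigma_finite_measure (Pi\<^sub>M I (\<lambda>_. lborel :: real measure))"
proof -
  interpret product_sigma_finite "\<lambda>_::'i. lborel :: real measure" by standard
  show ?thesis by (rule sigma_finite) fact
qed

text \<open>Lebesgue measure is determined by its values on boxes, and the preimage of a box is an
  interval in coordinate \<open>l\<close> times a box in the others.\<close>

lemma lborel_eq_distr_hyperplane_point:
  "(lborel :: (real^'n::finite) measure) =
    distr (lborel \<Otimes>\<^sub>M Pi\<^sub>M (UNIV - {l}) (\<lambda>_. lborel)) borel (\<lambda>p. hyperplane_point l (fst p) (snd p))"
proof (rule lborel_eqI)
  interpret product_sigma_finite "\<lambda>_::'n. lborel :: real measure" by standard
  interpret Y: sigma_finite_measure "Pi\<^sub>M (UNIV - {l}) (\<lambda>_. lborel :: real measure)"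
    by (rule sigma_finite_PiM_lborel) simp
  fix a b :: "real^'n" assume le: "\<And>i. i \<in> Basis \<Longrightarrow> a \<bullet> i \<le> b \<bullet> i"
  then have le': "a $ i \<le> b $ i" for i
    using le [of "axis i 1"] by (auto simp: Basis_vec_eq inner_axis)
  let ?M = "lborel \<Otimes>\<^sub>M Pi\<^sub>M (UNIV - {l}) (\<lambda>_. lborel :: real measure)"
  have pre: "(\<lambda>p. hyperplane_point l (fst p) (snd p)) -` box a b \<inter> space ?M
      = {a $ l<..<b $ l} \<times> Pi\<^sub>E (UNIV - {l}) (\<lambda>i. {a $ i<..<b $ i})" (is "?L = ?R")
  proof (intro set_eqI)
    fix p :: "real \<times> ('n \<Rightarrow> real)"
    have "hyperplane_point l (fst p) (snd p) \<in> box a b \<longleftrightarrow>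
        fst p \<in> {a $ l<..<b $ l} \<and> (\<forall>i\<in>UNIV - {l}. snd p i \<in> {a $ i<..<b $ i})"
      by (auto simp: mem_box_cart hyperplane_point_def)
    then show "p \<in> ?L \<longleftrightarrow> p \<in> ?R"
      by (cases p) (auto simp: space_pair_measure space_PiM PiE_iff)
  qed
  have "emeasure (distr ?M borel (\<lambda>p. hyperplane_point l (fst p) (snd p))) (box a b)
      = emeasure ?M ({a $ l<..<b $ l} \<times> Pi\<^sub>E (UNIV - {l}) (\<lambda>i. {a $ i<..<b $ i}))"
    by (subst emeasure_distr) (auto simp: pre)
  also have "\<dots> = emeasure lborel {a $ l<..<b $ l}
      * emeasure (Pi\<^sub>M (UNIV - {l}) (\<lambda>_. lborel)) (Pi\<^sub>E (UNIV - {l}) (\<lambda>i. {a $ i<..<b $ i}))"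
    by (rule Y.emeasure_pair_measure_Times) (auto intro!: sets_PiM_I_finite)
  also have "\<dots> = ennreal (b $ l - a $ l) * (\<Prod>i\<in>UNIV - {l}. ennreal (b $ i - a $ i))"
    using le' by (subst emeasure_PiM) auto
  also have "\<dots> = (\<Prod>i\<in>UNIV. ennreal (b $ i - a $ i))"
    by (rule prod.remove [symmetric]) auto
  also have "\<dots> = ennreal (\<Prod>i\<in>UNIV. b $ i - a $ i)"
    using le' by (intro prod_ennreal) auto
  also have "(\<Prod>i\<in>UNIV. b $ i - a $ i) = (\<Prod>i\<in>Basis. (b - a) \<bullet> i)"
    unfolding Basis_vec_eq
    by (subst prod.reindex) (auto simp: inj_on_def axis_eq_axis inner_axis)
  finally show "emeasure (distr ?M borel (\<lambda>p. hyperplane_point l (fst p) (snd p))) (box a b)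
      = ennreal (\<Prod>i\<in>Basis. (b - a) \<bullet> i)" .
qed simp

lemma nn_integral_lborel_prod_eq:
  fixes H :: "real \<times> (real^'n::finite) \<Rightarrow> ennreal"
  assumes [measurable]: "H \<in> borel_measurable borel"
  shows "(\<integral>\<^sup>+z. H z \<partial>lborel) = (\<integral>\<^sup>+t. \<integral>\<^sup>+x. H (t, x) \<partial>lborel \<partial>lborel)"
  unfolding lborel_prod [symmetric]
  by (rule lborel.nn_integral_fst [symmetric]) (use assms in \<open>simp add: lborel_prod\<close>)

text \<open>Tonelli brings the integral into the order of \<open>norm_Le\<close>, with the
  coordinate along e_l outermost and time in the middle.\<close>

lemma nn_integral_hyperplane:
  fixes H :: "real \<times> (real^'n::finite) \<Rightarrow> ennreal"
  assumes [measurable]: "H \<in> borel_measurable borel"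
  shows "(\<integral>\<^sup>+t. \<integral>\<^sup>+x. H (t, x) \<partial>lborel \<partial>lborel)
    = (\<integral>\<^sup>+s. \<integral>\<^sup>+t. \<integral>\<^sup>+y. H (t, hyperplane_point l s y) \<partial>Pi\<^sub>M (UNIV - {l}) (\<lambda>_. lborel) \<partial>lborel \<partial>lborel)"
proof -
  let ?Y = "Pi\<^sub>M (UNIV - {l}) (\<lambda>_. lborel :: real measure)"
  interpret Y: sigma_finite_measure ?Y
    by (rule sigma_finite_PiM_lborel) simp
  have [measurable]: "H \<in> borel_measurable (borel \<Otimes>\<^sub>M borel)"
    using assms by (simp add: borel_prod)
  have "(\<integral>\<^sup>+x. H (t, x) \<partial>lborel) = (\<integral>\<^sup>+s. \<integral>\<^sup>+y. H (t, hyperplane_point l s y) \<partial>?Y \<partial>lborel)" for t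
  proof -
    have "(\<integral>\<^sup>+x. H (t, x) \<partial>lborel) = (\<integral>\<^sup>+p. H (t, hyperplane_point l (fst p) (snd p)) \<partial>(lborel \<Otimes>\<^sub>M ?Y))"
      by (subst lborel_eq_distr_hyperplane_point [of l]) (rule nn_integral_distr; measurable)
    also have "\<dots> = (\<integral>\<^sup>+s. \<integral>\<^sup>+y. H (t, hyperplane_point l s y) \<partial>?Y \<partial>lborel)"
      by (subst Y.nn_integral_fst [symmetric]) auto
    finally show ?thesis .
  qed
  then have "(\<integral>\<^sup>+t. \<integral>\<^sup>+x. H (t, x) \<partial>lborel \<partial>lborel)
      = (\<integral>\<^sup>+t. \<integral>\<^sup>+s. \<integral>\<^sup>+y. H (t, hyperplane_point l s y) \<partial>?Y \<partial>lborel \<partial>lborel)"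
    by simp
  also have "\<dots> = (\<integral>\<^sup>+s. \<integral>\<^sup>+t. \<integral>\<^sup>+y. H (t, hyperplane_point l s y) \<partial>?Y \<partial>lborel \<partial>lborel)"
    by (rule lborel_pair.Fubini') measurable
  finally show ?thesis .
qed

lemma AE_lborel_prod:
  fixes P :: "real \<times> (real^'n::finite) \<Rightarrow> bool"
  assumes "AE z in lborel. P z"
  shows "AE t in lborel. AE x in lborel. P (t, x)"
  using assms unfolding lborel_prod [symmetric] by (rule lborel_pair.AE_pair)

text \<open>The indicator of a Borel null set covering the exceptions has integral 0; in the sliced
  form, the vanishing is peeled off one integral at a time.\<close>

lemma AE_hyperplane:
  fixes P :: "real \<times> (real^'n::finite) \<Rightarrow> bool"
  assumes "AE z in lborel. P z"
  shows "AE s in lborel. AE t in lborel. AE y in Pi\<^sub>M (UNIV - {l}) (\<lambda>_. lborel). P (t, hyperplane_point l s y)"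
proof -
  let ?Y = "Pi\<^sub>M (UNIV - {l}) (\<lambda>_. lborel :: real measure)"
  interpret Y: sigma_finite_measure ?Y
    by (rule sigma_finite_PiM_lborel) simp
  obtain N where N: "{z \<in> space lborel. \<not> P z} \<subseteq> N" "emeasure lborel N = 0" "N \<in> sets lborel"
    using assms by (rule AE_E)
  define H where "H = (indicator N :: real \<times> (real^'n) \<Rightarrow> ennreal)"
  have Hm [measurable]: "H \<in> borel_measurable borel" using N(3) by (simp add: H_def)
  have [measurable]: "H \<in> borel_measurable (borel \<Otimes>\<^sub>M borel)"
    using Hm by (simp add: borel_prod)
  have "(\<integral>\<^sup>+z. H z \<partial>lborel) = 0" using N by (simp add: H_def)
  then have "(\<integral>\<^sup>+s. \<integral>\<^sup>+t. \<integral>\<^sup>+y. H (t, hyperplane_point l s y) \<partial>?Y \<partial>lborel \<partial>lborel) = 0"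
    by (simp add: nn_integral_lborel_prod_eq nn_integral_hyperplane [of _ l])
  then have "AE s in lborel. (\<integral>\<^sup>+t. \<integral>\<^sup>+y. H (t, hyperplane_point l s y) \<partial>?Y \<partial>lborel) = 0"
    by (subst (asm) nn_integral_0_iff_AE) measurable
  then show ?thesis
  proof eventually_elim
    case (elim s)
    then have "AE t in lborel. (\<integral>\<^sup>+y. H (t, hyperplane_point l s y) \<partial>?Y) = 0"
      by (subst (asm) nn_integral_0_iff_AE) measurable
    then show ?case
    proof eventually_elim
      case (elim t)
      then have "AE y in ?Y. H (t, hyperplane_point l s y) = 0"
        by (subst (asm) nn_integral_0_iff_AE) measurable
      then show ?case
        using N(1) by (auto elim!: eventually_mono simp: H_def indicator_eq_0_iff)
    qed
  qed
qed

section \<open>Mixed norms: dependence on null sets and the product estimate\<close>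

lemma norm_Le_cong_AE:
  assumes "AE z in lborel. v z = v' z"
  shows "norm_Le l a b c UNIV v = norm_Le l a b c UNIV v'"
  unfolding norm_Le_def
  by (intro arg_cong2 [where f = epowr] refl nn_integral_cong_AE)
     (use AE_hyperplane [OF assms, of l] in
       \<open>auto elim!: eventually_mono intro!: arg_cong2 [where f = epowr] nn_integral_cong_AE\<close>)

lemma norm_LtLx_cong_AE:
  assumes "AE t in lborel. AE x in lborel. v (t, x) = v' (t, x)"
  shows "norm_LtLx p q UNIV v = norm_LtLx p q UNIV v'"
  unfolding norm_LtLx_def
  by (intro arg_cong2 [where f = epowr] refl nn_integral_cong_AE)
     (use assms in \<open>auto elim!: eventually_mono intro!: arg_cong2 [where f = epowr] nn_integral_cong_AE\<close>)

lemma norm_LtLx_2: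
  "norm_LtLx 2 2 UNIV v = epowr (\<integral>\<^sup>+t. \<integral>\<^sup>+x. ennreal (norm (v (t, x)))^2 \<partial>lborel \<partial>lborel) (1 / 2)"
  by (simp add: norm_LtLx_def ennreal_power)

text \<open>Hoelder and interpolation in one step: |w|^2 is split into |w|^(2 \<theta>) and |w|^(2
  (1 - \<theta>)), measured with innermost exponents \<open>c1\<close> and \<open>c2\<close>. Taking
  \<open>c1 = c2\<close> gives the plain inequality.\<close>

lemma norm_LtLx_mult_le:
  fixes w m :: "real \<times> (real^'n::finite) \<Rightarrow> complex"
  assumes wm: "w \<in> borel_measurable lebesgue" "m \<in> borel_measurable lebesgue"
    and pos: "a > 0" "b > 0" "c1 > 0" "c2 > 0" "a' > 0" "b' > 0" "c' > 0" "0 < \<theta>" "\<theta> < 1"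
    and sums: "1 / a + 1 / a' = 1 / 2" "1 / b + 1 / b' = 1 / 2" "\<theta> / c1 + (1 - \<theta>) / c2 + 1 / c' = 1 / 2"
    and B: "norm_Le l a b c1 UNIV w \<le> B" "norm_Le l a b c2 UNIV w \<le> B"
  shows "norm_LtLx 2 2 UNIV (\<lambda>z. w z * m z) \<le> B * norm_Le l a' b' c' UNIV m"
proof -
  let ?Y = "Pi\<^sub>M (UNIV - {l}) (\<lambda>_. lborel :: real measure)"
  obtain u where u [measurable]: "u \<in> borel_measurable lborel" and wu: "AE z in lborel. w z = u z"
    using completion_ex_borel_measurable_complex [OF wm(1)] by auto
  obtain v where v [measurable]: "v \<in> borel_measurable lborel" and mv: "AE z in lborel. m z = v z"
    using completion_ex_borel_measurable_complex [OF wm(2)] by auto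
  have [measurable]: "u \<in> borel_measurable (borel \<Otimes>\<^sub>M borel)" "v \<in> borel_measurable (borel \<Otimes>\<^sub>M borel)"
    using u v by (simp_all add: borel_prod)
  have wmuv: "norm_LtLx 2 2 UNIV (\<lambda>z. w z * m z) = norm_LtLx 2 2 UNIV (\<lambda>z. u z * v z)"
  proof (intro norm_LtLx_cong_AE AE_lborel_prod)
    show "AE z in lborel. w z * m z = u z * v z" using wu mv by eventually_elim simp
  qed
  let ?u = "\<lambda>p. ennreal (norm (u (snd (fst p), hyperplane_point l (fst (fst p)) (snd p))))"
  let ?v = "\<lambda>p. ennreal (norm (v (snd (fst p), hyperplane_point l (fst (fst p)) (snd p))))"
  have um [measurable]: "?u \<in> borel_measurable ((lborel \<Otimes>\<^sub>M lborel) \<Otimes>\<^sub>M ?Y)"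
    "?v \<in> borel_measurable ((lborel \<Otimes>\<^sub>M lborel) \<Otimes>\<^sub>M ?Y)"
    by measurable
  have U: "ennreal (norm (u z)) ^ 2 * ennreal (norm (v z)) ^ 2
     = epowr (ennreal (norm (u z))) (2 * \<theta>) * epowr (ennreal (norm (u z))) (2 * (1 - \<theta>)) * epowr (ennreal (norm (v z))) 2" for z
    by (simp only: epowr_add [symmetric] epowr_2 [symmetric]) (simp add: algebra_simps)
  have "(\<integral>\<^sup>+t. \<integral>\<^sup>+x. ennreal (norm (u (t, x) * v (t, x)))^2 \<partial>lborel \<partial>lborel)
      = (\<integral>\<^sup>+s. \<integral>\<^sup>+t. \<integral>\<^sup>+y. ennreal (norm (u (t, hyperplane_point l s y))) ^ 2 * ennreal (norm (v (t, hyperplane_point l s y))) ^ 2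
          \<partial>?Y \<partial>lborel \<partial>lborel)"
    using nn_integral_hyperplane [of "\<lambda>z. ennreal (norm (u z * v z)) ^ 2" l]
    by (simp add: norm_mult ennreal_mult' power_mult_distrib)
  also have "\<dots> \<le> epowr (norm_Le l a b c1 UNIV u) (2 * \<theta>) * epowr (norm_Le l a b c2 UNIV u) (2 * (1 - \<theta>))
      * epowr (norm_Le l a' b' c' UNIV v) 2"
  proof -
    \<comment> \<open>In the two outer levels both copies of \<open>w\<close> carry the same
      exponent, so \<theta> drops out of the scaling relation.\<close>
    have *: "2 * \<theta> / k + 2 * (1 - \<theta>) / k + 2 / k' = 1" if "1 / k + 1 / k' = 1 / 2" for k k' :: real
    proof -
      have "2 * \<theta> / k + 2 * (1 - \<theta>) / k + 2 / k' = 2 * (1 / k + 1 / k')"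
        by (simp add: add_divide_distrib diff_divide_distrib algebra_simps)
      with that show ?thesis by simp
    qed
    have "2 * \<theta> / c1 + 2 * (1 - \<theta>) / c2 + 2 / c' = 2 * (\<theta> / c1 + (1 - \<theta>) / c2 + 1 / c')"
      by (simp add: algebra_simps)
    then have **: "2 * \<theta> / c1 + 2 * (1 - \<theta>) / c2 + 2 / c' = 1" using sums(3) by simp
    show ?thesis
      using mixed_Holder3 [OF sigma_finite_lborel sigma_finite_PiM_lborel [of "UNIV - {l}"] um(1) um(1) um(2)
        pos(1) pos(1) pos(5) pos(2) pos(2) pos(6) pos(3) pos(4) pos(7), of "2 * \<theta>" "2 * (1 - \<theta>)" 2] pos
        * [OF sums(1)] * [OF sums(2)] **
      unfolding norm_Le_def U by (simp add: epowr_epowr del: epowr_2)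
  qed
  also have "\<dots> \<le> epowr B (2 * \<theta>) * epowr B (2 * (1 - \<theta>)) * epowr (norm_Le l a' b' c' UNIV v) 2"
    using pos B unfolding norm_Le_cong_AE [OF wu]
    by (intro mult_mono epowr_mono) auto
  also have "\<dots> = epowr (B * norm_Le l a' b' c' UNIV v) 2"
    unfolding epowr_add [symmetric] epowr_mult by (simp add: algebra_simps)
  finally have "norm_LtLx 2 2 UNIV (\<lambda>z. u z * v z) \<le> epowr (epowr (B * norm_Le l a' b' c' UNIV v) 2) (1 / 2)"
    unfolding norm_LtLx_2 by (rule epowr_mono) simp
  then show ?thesis
    unfolding wmuv norm_Le_cong_AE [OF mv] epowr_epowr by simp
qed

subsection \<open>Bilinear estimate\<close>

text \<open>If no coordinate exceeded the threshold, summing squares would give |\<xi>|^2 \<le> d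
  |\<xi>|^2 / (4 d) = |\<xi>|^2 / 4. Removing the sets with smaller index leaves exactly the least
  index that exceeds it.\<close>

lemma sum_indicator_freq_set:
  fixes \<xi> :: "real^'n::{finite,linorder}"
  assumes "\<xi> \<noteq> 0"
  shows "(\<Sum>l\<in>UNIV. indicator (freq_set l) \<xi> :: complex) = 1"
proof -
  define S where "S = {l. \<bar>\<xi> $ l\<bar> / norm \<xi> > 1 / (2 * sqrt (real CARD('n)))}"
  have "S \<noteq> {}"
  proof
    assume "S = {}"
    then have le: "\<bar>\<xi> $ l\<bar> \<le> norm \<xi> / (2 * sqrt (real CARD('n)))" for l
      using assms by (auto simp: S_def not_less field_simps)
    have "(norm \<xi>)\<^sup>2 = (\<Sum>l\<in>UNIV. \<bar>\<xi> $ l\<bar>\<^sup>2)"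
      by (simp add: norm_vec_def L2_set_def sum_nonneg)
    also have "\<dots> \<le> (\<Sum>l\<in>(UNIV::'n set). (norm \<xi> / (2 * sqrt (real CARD('n))))\<^sup>2)"
      by (intro sum_mono power_mono le) auto
    also have "\<dots> = (norm \<xi>)\<^sup>2 / 4"
      by (simp add: power_divide power_mult_distrib)
    finally show False using assms by simp
  qed
  then have Min: "Min S \<in> S" "\<And>l. l \<in> S \<Longrightarrow> Min S \<le> l" by auto
  have "\<xi> \<in> freq_set l \<longleftrightarrow> l \<in> S \<and> (\<forall>l'<l. l' \<notin> S)" for l
    by (auto simp: freq_set_def S_def)
  then have "\<xi> \<in> freq_set l \<longleftrightarrow> l = Min S" for l
    using Min by (metis leD le_less_linear order_antisym)
  then have "(\<Sum>l\<in>UNIV. indicator (freq_set l) \<xi> :: complex) = (\<Sum>l\<in>UNIV. if l = Min S then 1 else 0)"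
    by (intro sum.cong) (auto simp: indicator_def)
  then show ?thesis by simp
qed

text \<open>Each \<open>is_U\<close> brings its own transform of \<open>f\<close>; uniqueness makes
  them agree almost everywhere, after which the indicators sum to 1. Pairing with Gaussians carries
  this identity back from frequency to space.\<close>

lemma is_U_sum:
  fixes f :: "real^'n::{finite,linorder} \<Rightarrow> complex"
  assumes "\<And>l. is_U l f (g l)"
  shows "AE x in lborel. f x = (\<Sum>l\<in>UNIV. g l x)"
proof -
  obtain F where fF: "\<And>l. has_fourier_transform f (F l)"
    and gF: "\<And>l. has_fourier_transform (g l) (\<lambda>\<xi>. indicator (freq_set l) \<xi> * F l \<xi>)"
    using assms unfolding is_U_def by metis
  have f: "tempered f" and F: "\<And>l. tempered (F l)" and g: "\<And>l. tempered (g l)"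
    and iF: "\<And>l. tempered (\<lambda>\<xi>. indicator (freq_set l) \<xi> * F l \<xi>)"
    using fF gF by (auto simp: has_fourier_transform_def)
  \<comment> \<open>An arbitrary index, whose transform serves as the common one.\<close>
  define l0 :: 'n where "l0 = undefined"
  have "AE \<xi> in lborel. \<forall>l. F l \<xi> = F l0 \<xi>"
    unfolding AE_all_countable by (intro allI fourier_transform_unique [OF fF fF])
  moreover have "AE \<xi> in lborel. \<xi> \<noteq> (0 :: real^'n::{finite,linorder})"
    by (rule AE_lborel_singleton)
  ultimately have sumF: "AE \<xi> in lborel. (\<Sum>l\<in>UNIV. indicator (freq_set l) \<xi> * F l \<xi>) = F l0 \<xi>"
  proof eventually_elim
    case (elim \<xi>)
    then have "(\<Sum>l\<in>UNIV. indicator (freq_set l) \<xi> * F l \<xi>) = (\<Sum>l\<in>UNIV. indicator (freq_set l) \<xi>) * F l0 \<xi>"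
      unfolding sum_distrib_right by (intro sum.cong) auto
    then show ?case using elim by (simp add: sum_indicator_freq_set)
  qed
  show ?thesis
  proof (rule AE_eq_if_gauss_integrals_eq)
    show "tempered (\<lambda>x. \<Sum>l\<in>UNIV. g l x)" by (intro tempered_sum g) auto
    fix a :: real and x0 :: "real^'n::{finite,linorder}" assume a: "a > 0"
    let ?G = "gauss (1 / (4 * a)) 0 x0" and ?C = "complex_of_real (sqrt (pi * (4 * a)) ^ DIM(real^'n::{finite,linorder}))"
    have a4: "1 / (4 * a) > 0" using a by simp
    have "(LINT x|lebesgue. (\<Sum>l\<in>UNIV. g l x) * gauss a x0 0 x) = (\<Sum>l\<in>UNIV. LINT x|lebesgue. g l x * gauss a x0 0 x)"
      unfolding sum_distrib_right
      by (intro Bochner_Integration.integral_sum integrable_tempered_gauss g a)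
    also have "\<dots> = (\<Sum>l\<in>UNIV. LINT \<xi>|lebesgue. (indicator (freq_set l) \<xi> * F l \<xi>) * ?G \<xi>) / ?C"
      unfolding has_fourier_transform_gauss [OF gF a] sum_divide_distrib ..
    also have "(\<Sum>l\<in>UNIV. LINT \<xi>|lebesgue. (indicator (freq_set l) \<xi> * F l \<xi>) * ?G \<xi>)
        = (LINT \<xi>|lebesgue. (\<Sum>l\<in>UNIV. indicator (freq_set l) \<xi> * F l \<xi>) * ?G \<xi>)"
      unfolding sum_distrib_right
      by (intro Bochner_Integration.integral_sum [symmetric] integrable_tempered_gauss iF a4)
    also have "\<dots> = (LINT \<xi>|lebesgue. F l0 \<xi> * ?G \<xi>)"
    proof (rule Bochner_Integration.integral_cong_AE)
      show "AE \<xi> in lebesgue. (\<Sum>l\<in>UNIV. indicator (freq_set l) \<xi> * F l \<xi>) * ?G \<xi> = F l0 \<xi> * ?G \<xi>"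
        using AE_completion [OF sumF] by eventually_elim simp
    qed (intro borel_measurable_integrable integrable_tempered_gauss tempered_sum iF F a4; simp)+
    also have "\<dots> / ?C = (LINT x|lebesgue. f x * gauss a x0 0 x)"
      by (simp only: has_fourier_transform_gauss [OF fF [of l0] a])
    finally show "(LINT x|lebesgue. f x * gauss a x0 0 x) = (LINT x|lebesgue. (\<Sum>l\<in>UNIV. g l x) * gauss a x0 0 x)" ..
  qed (rule f)
qed

text \<open>The two transforms of \<open>f\<close> agree almost everywhere, hence so do their
  truncations, and injectivity returns to \<open>g\<close> and \<open>h\<close>.\<close>

lemma is_U_unique:
  fixes f :: "real^'n::{finite,linorder} \<Rightarrow> complex"
  assumes "is_U l f g" "is_U l f h"
  shows "AE x in lborel. g x = h x"
proof -
  obtain F G where F: "has_fourier_transform f F" "has_fourier_transform g (\<lambda>\<xi>. indicator (freq_set l) \<xi> * F \<xi>)"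
    and G: "has_fourier_transform f G" "has_fourier_transform h (\<lambda>\<xi>. indicator (freq_set l) \<xi> * G \<xi>)"
    using assms by (auto simp: is_U_def)
  have "AE \<xi> in lborel. indicator (freq_set l) \<xi> * F \<xi> = indicator (freq_set l) \<xi> * G \<xi>"
    using fourier_transform_unique [OF F(1) G(1)] by eventually_elim simp
  with F(2) G(2) show ?thesis by (rule inverse_fourier_transform_unique)
qed

text \<open>Uniqueness is available for almost every time slice. Passing from slices to spacetime
  needs a measurable exceptional set, which the Borel representatives \<open>u1\<close> and
  \<open>u2\<close> provide.\<close>

lemma is_U_spacetime_unique:
  fixes v :: "real \<times> (real^'n::{finite,linorder}) \<Rightarrow> complex"
  assumes w: "is_U_spacetime UNIV l v w1" "is_U_spacetime UNIV l v w2"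
  shows "AE z in lborel. w1 z = w2 z"
proof -
  obtain u1 where u1 [measurable]: "u1 \<in> borel_measurable lborel" and wu1: "AE z in lborel. w1 z = u1 z"
    using completion_ex_borel_measurable_complex [of w1 lborel] w by (auto simp: is_U_spacetime_def)
  obtain u2 where u2 [measurable]: "u2 \<in> borel_measurable lborel" and wu2: "AE z in lborel. w2 z = u2 z"
    using completion_ex_borel_measurable_complex [of w2 lborel] w by (auto simp: is_U_spacetime_def)
  have "AE t in lborel. is_U l (\<lambda>x. v (t, x)) (\<lambda>x. w1 (t, x))"
    "AE t in lborel. is_U l (\<lambda>x. v (t, x)) (\<lambda>x. w2 (t, x))"
    using w by (auto simp: is_U_spacetime_def)
  then have "AE t in lborel. AE x in lborel. u1 (t, x) = u2 (t, x)"
    using AE_lborel_prod [OF wu1] AE_lborel_prod [OF wu2]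
  proof eventually_elim
    case (elim t)
    show ?case
      using is_U_unique [OF elim(1,2)] elim(3,4) by eventually_elim simp
  qed
  then have "AE z in lborel \<Otimes>\<^sub>M lborel. u1 z = u2 z"
  proof (rule lborel_pair.AE_pair_measure [rotated])
    show "{z \<in> space (lborel \<Otimes>\<^sub>M lborel). u1 z = u2 z} \<in> sets (lborel \<Otimes>\<^sub>M lborel)"
      unfolding lborel_prod by measurable
  qed
  then have "AE z in lborel. u1 z = u2 z" by (simp only: lborel_prod)
  with wu1 wu2 show ?thesis by eventually_elim simp
qed

lemma norm_Le_U_eq:
  fixes v :: "real \<times> (real^'n::{finite,linorder}) \<Rightarrow> complex"
  assumes "is_U_spacetime UNIV l v w"
  shows "norm_Le_U l a b c UNIV v = norm_Le l a b c UNIV w"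
  unfolding norm_Le_U_def
proof (rule INF_eq_const)
  show "norm_Le l a b c UNIV w' = norm_Le l a b c UNIV w" if "w' \<in> {w. is_U_spacetime UNIV l v w}" for w'
    using that assms by (intro norm_Le_cong_AE is_U_spacetime_unique) simp_all
qed (use assms in blast)

text \<open>Pointwise Cauchy-Schwarz stands in for the triangle inequality: |sum|^2 is at most
  \<open>card I\<close> times the sum of squares, and summing the \<open>card I\<close> bounds gives
  \<open>(card I)^2 * B^2\<close>.\<close>

lemma norm_LtLx_sum_le:
  fixes v :: "'i \<Rightarrow> real \<times> (real^'n::finite) \<Rightarrow> complex"
  assumes "finite I" and v: "\<And>l. l \<in> I \<Longrightarrow> v l \<in> borel_measurable lebesgue"
    and B: "\<And>l. l \<in> I \<Longrightarrow> norm_LtLx 2 2 UNIV (v l) \<le> B"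
  shows "norm_LtLx 2 2 UNIV (\<lambda>z. \<Sum>l\<in>I. v l z) \<le> ennreal (card I) * B"
proof -
  have "\<forall>l\<in>I. \<exists>u. u \<in> borel_measurable lborel \<and> (AE z in lborel. v l z = u z)"
    using completion_ex_borel_measurable_complex [OF v] by (simp add: Bex_def)
  from bchoice [OF this] obtain u where
    u: "\<And>l. l \<in> I \<Longrightarrow> u l \<in> borel_measurable lborel \<and> (AE z in lborel. v l z = u l z)"
    by blast
  have [measurable]: "u l \<in> borel_measurable borel" if "l \<in> I" for l using u [OF that] by simp
  have N: "norm_LtLx 2 2 UNIV w = epowr (\<integral>\<^sup>+z. ennreal (norm (w z)) ^ 2 \<partial>lborel) (1 / 2)"
    if [measurable]: "w \<in> borel_measurable borel" for w :: "real \<times> (real^'n) \<Rightarrow> complex"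
    by (simp add: norm_LtLx_2 nn_integral_lborel_prod_eq)
  have Nu: "(\<integral>\<^sup>+z. ennreal (norm (u l z)) ^ 2 \<partial>lborel) \<le> B ^ 2" if l: "l \<in> I" for l
  proof -
    have "norm_LtLx 2 2 UNIV (u l) \<le> B"
      using B [OF l] norm_LtLx_cong_AE [OF AE_lborel_prod [of "\<lambda>z. v l z = u l z"], of 2 2] u [OF l] by simp
    then have "epowr (norm_LtLx 2 2 UNIV (u l)) 2 \<le> epowr B 2" by (intro epowr_mono) auto
    then show ?thesis using l by (simp add: N epowr_epowr del: epowr_2) simp
  qed
  have pt: "ennreal (norm (\<Sum>l\<in>I. u l z)) ^ 2 \<le> ennreal (card I) * (\<Sum>l\<in>I. ennreal (norm (u l z)) ^ 2)" for z
  proof -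
    have "(norm (\<Sum>l\<in>I. u l z))\<^sup>2 \<le> (\<Sum>l\<in>I. norm (u l z))\<^sup>2"
      by (intro power_mono norm_sum) auto
    also have "\<dots> \<le> (\<Sum>l\<in>I. (norm (u l z))\<^sup>2) * card I"
      by (rule sum_squared_le_sum_of_squares)
    finally show ?thesis
      by (simp add: ennreal_power sum_ennreal mult.commute sum_nonneg flip: ennreal_mult)
  qed
  have "(\<integral>\<^sup>+z. ennreal (norm (\<Sum>l\<in>I. u l z)) ^ 2 \<partial>lborel)
      \<le> (\<integral>\<^sup>+z. ennreal (card I) * (\<Sum>l\<in>I. ennreal (norm (u l z)) ^ 2) \<partial>lborel)"
    by (intro nn_integral_mono pt)
  also have "\<dots> = ennreal (card I) * (\<Sum>l\<in>I. \<integral>\<^sup>+z. ennreal (norm (u l z)) ^ 2 \<partial>lborel)"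
    by (subst nn_integral_cmult, measurable, subst nn_integral_sum) auto
  also have "\<dots> \<le> ennreal (card I) * (\<Sum>l\<in>I. B ^ 2)"
    by (intro mult_left_mono sum_mono Nu) auto
  also have "\<dots> = epowr (ennreal (card I) * B) 2"
    by (simp add: power2_eq_square mult_ac ennreal_of_nat_eq_real_of_nat)
  finally have "norm_LtLx 2 2 UNIV (\<lambda>z. \<Sum>l\<in>I. u l z) \<le> epowr (epowr (ennreal (card I) * B) 2) (1 / 2)"
    by (subst N) (auto intro!: epowr_mono)
  moreover have "norm_LtLx 2 2 UNIV (\<lambda>z. \<Sum>l\<in>I. v l z) = norm_LtLx 2 2 UNIV (\<lambda>z. \<Sum>l\<in>I. u l z)"
  proof (intro norm_LtLx_cong_AE AE_lborel_prod)
    have "AE z in lborel. \<forall>l\<in>I. v l z = u l z"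
      using u assms(1) by (intro AE_finite_allI) auto
    then show "AE z in lborel. (\<Sum>l\<in>I. v l z) = (\<Sum>l\<in>I. u l z)"
      by eventually_elim simp
  qed
  ultimately show ?thesis by (simp only: epowr_epowr) simp
qed

text \<open>\<open>x\<close> and \<open>y\<close> stand for the powers of N_+ and N_- attached to
  the component norms, \<open>P\<close> and \<open>Q\<close> for the full norms dominating them. The
  factor \<open>CARD('n)\<close> counts the frequency pieces.\<close>

lemma bilinear_bound:
  fixes hp hm :: "real \<times> (real^'n::{finite,linorder}) \<Rightarrow> complex"
  assumes hp: "hp \<in> borel_measurable lebesgue" and hm: "hm \<in> borel_measurable lebesgue"
    and pos: "a > 0" "b > 0" "c1 > 0" "c2 > 0" "a' > 0" "b' > 0" "c' > 0" "0 < \<theta>" "\<theta> < 1" "x > 0" "y > 0"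
    and sums: "1 / a + 1 / a' = 1 / 2" "1 / b + 1 / b' = 1 / 2" "\<theta> / c1 + (1 - \<theta>) / c2 + 1 / c' = 1 / 2"
    and P: "\<And>l. ennreal x * norm_Le_U l a b c1 UNIV hp \<le> P" "\<And>l. ennreal x * norm_Le_U l a b c2 UNIV hp \<le> P"
    and Q: "\<And>l. ennreal y * norm_Le l a' b' c' UNIV hm \<le> Q"
  shows "norm_LtLx 2 2 UNIV (\<lambda>z. hp z * hm z) \<le> ennreal (real CARD('n) / (x * y)) * (P * Q)"
proof -
  have cancel: "A \<le> ennreal (1 / r) * B" if "r > 0" "ennreal r * A \<le> B" for r and A B :: ennreal
  proof -
    have "A = ennreal (1 / r) * (ennreal r * A)"
      using that(1) by (simp flip: mult.assoc ennreal_mult)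
    also have "\<dots> \<le> ennreal (1 / r) * B" using that(2) by (intro mult_left_mono) auto
    finally show ?thesis .
  qed
  have A: "norm_Le l a' b' c' UNIV hm \<le> ennreal (1 / y) * Q" for l
    using Q pos by (intro cancel)
  \<comment> \<open>An undefined projection makes \<open>P\<close> infinite, and this makes the
    right-hand side infinite only if \<open>Q\<close> is nonzero.\<close>
  consider "Q = 0" | l where "Q \<noteq> 0" "\<not> (\<exists>w. is_U_spacetime UNIV l hp w)" | "\<forall>l. \<exists>w. is_U_spacetime UNIV l hp w"
    by blast
  then show ?thesis
  proof cases
    case 1
    \<comment> \<open>\<open>U\<^sub>l h\<^sub>+\<close> may be undefined here, but \<open>h\<^sub>+\<close> itself with the bound \<open>\<infinity>\<close> will do, as \<open>\<infinity> * 0 = 0\<close>.\<close>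
    fix l :: 'n
    have "norm_LtLx 2 2 UNIV (\<lambda>z. hp z * hm z) \<le> top * norm_Le l a' b' c' UNIV hm"
      by (rule norm_LtLx_mult_le [OF hp hm pos(1-9) sums]) auto
    also have "norm_Le l a' b' c' UNIV hm = 0" using A [of l] 1 by simp
    finally show ?thesis by simp
  next
    case (2 l)
    then have "norm_Le_U l a b c1 UNIV hp = top" by (simp add: norm_Le_U_def)
    with P(1) [of l] pos have "P = top" by (simp add: ennreal_mult_top top_unique)
    with 2 pos show ?thesis by (simp add: ennreal_mult_top ennreal_top_mult)
  next
    case 3
    then obtain w where w: "\<And>l. is_U_spacetime UNIV l hp (w l)" by metis
    have wm: "w l \<in> borel_measurable lebesgue" for l using w [of l] by (simp add: is_U_spacetime_def)
    have "AE t in lborel. \<forall>l. is_U l (\<lambda>x. hp (t, x)) (\<lambda>x. w l (t, x))"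
      using w unfolding AE_all_countable by (simp add: is_U_spacetime_def)
    then have "AE t in lborel. AE x in lborel. hp (t, x) = (\<Sum>l\<in>UNIV. w l (t, x))"
      by eventually_elim (intro is_U_sum, blast)
    then have "AE t in lborel. AE x in lborel. hp (t, x) * hm (t, x) = (\<Sum>l\<in>UNIV. w l (t, x) * hm (t, x))"
      by (elim eventually_mono) (simp flip: sum_distrib_right)
    then have "norm_LtLx 2 2 UNIV (\<lambda>z. hp z * hm z) = norm_LtLx 2 2 UNIV (\<lambda>z. \<Sum>l\<in>UNIV. w l z * hm z)"
      by (rule norm_LtLx_cong_AE)
    also have "\<dots> \<le> ennreal CARD('n) * ((ennreal (1 / x) * P) * (ennreal (1 / y) * Q))"
    proof (rule norm_LtLx_sum_le)
      fix l
      show "(\<lambda>z. w l z * hm z) \<in> borel_measurable lebesgue" using wm hm by auto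
      have "norm_LtLx 2 2 UNIV (\<lambda>z. w l z * hm z) \<le> (ennreal (1 / x) * P) * norm_Le l a' b' c' UNIV hm"
        using P pos
        by (intro norm_LtLx_mult_le [OF wm hm pos(1-9) sums] cancel) (simp_all add: norm_Le_U_eq [OF w, symmetric])
      also have "\<dots> \<le> (ennreal (1 / x) * P) * (ennreal (1 / y) * Q)"
        by (intro mult_left_mono A) auto
      finally show "norm_LtLx 2 2 UNIV (\<lambda>z. w l z * hm z) \<le> (ennreal (1 / x) * P) * (ennreal (1 / y) * Q)" .
    qed simp
    also have "\<dots> = (ennreal CARD('n) * ennreal (1 / x) * ennreal (1 / y)) * (P * Q)"
      by (simp only: mult_ac)
    also have "ennreal CARD('n) * ennreal (1 / x) * ennreal (1 / y) = ennreal (real CARD('n) / (x * y))"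
      using pos by (simp flip: ennreal_mult)
    finally show ?thesis .
  qed
qed

section \<open>The estimates in the X and Y norms\<close>

lemma norm_XY_bounds:
  fixes v :: "real \<times> (real^'n::{finite,linorder}) \<Rightarrow> complex"
  shows "ennreal (real N powr \<alpha>) * norm_Le l (2 / (1 - e)) (2 / e) (2 / e) UNIV v \<le> norm_XY \<alpha> \<beta> e N UNIV v"
    and "ennreal (real N powr (- 1 / 2)) * norm_Le l (2 / (1 - e)) (2 / e)
      (2 * (real CARD('n) - 1) / (real CARD('n) - 2) / (1 - e)) UNIV v \<le> norm_XY \<alpha> \<beta> e N UNIV v"
    and "ennreal (real N powr (1 / 2)) * norm_Le_U l (2 / e) (2 / (1 - e)) (2 / (1 - e)) UNIV v \<le> norm_XY \<alpha> \<beta> e N UNIV v"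
    and "ennreal (real N powr \<beta>) * norm_Le_U l (2 / e) (2 / (1 - e)) (2 / e) UNIV v \<le> norm_XY \<alpha> \<beta> e N UNIV v"
proof -
  have le: "x \<le> c + (\<Sum>l\<in>UNIV. f l + g l) + (\<Sum>l\<in>UNIV. h l + k l)"
    if "x \<le> f l \<or> x \<le> g l \<or> x \<le> h l \<or> x \<le> k l" for x c :: ennreal and f g h k :: "'n \<Rightarrow> ennreal"
  proof -
    have "f l + g l \<le> (\<Sum>l\<in>UNIV. f l + g l)" "h l + k l \<le> (\<Sum>l\<in>UNIV. h l + k l)"
      using member_le_sum [of l UNIV "\<lambda>l. f l + g l"] member_le_sum [of l UNIV "\<lambda>l. h l + k l"] by auto
    moreover have "f l \<le> f l + g l" "g l \<le> f l + g l" "h l \<le> h l + k l" "k l \<le> h l + k l"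
      by simp_all
    ultimately have "x \<le> (\<Sum>l\<in>UNIV. f l + g l) \<or> x \<le> (\<Sum>l\<in>UNIV. h l + k l)"
      using that by (meson order_trans)
    then show ?thesis
      by (elim disjE) (blast intro: add_increasing add_increasing2 zero_le)+
  qed
  show "ennreal (real N powr \<alpha>) * norm_Le l (2 / (1 - e)) (2 / e) (2 / e) UNIV v \<le> norm_XY \<alpha> \<beta> e N UNIV v"
    "ennreal (real N powr (- 1 / 2)) * norm_Le l (2 / (1 - e)) (2 / e)
      (2 * (real CARD('n) - 1) / (real CARD('n) - 2) / (1 - e)) UNIV v \<le> norm_XY \<alpha> \<beta> e N UNIV v"
    "ennreal (real N powr (1 / 2)) * norm_Le_U l (2 / e) (2 / (1 - e)) (2 / (1 - e)) UNIV v \<le> norm_XY \<alpha> \<beta> e N UNIV v"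
    "ennreal (real N powr \<beta>) * norm_Le_U l (2 / e) (2 / (1 - e)) (2 / e) UNIV v \<le> norm_XY \<alpha> \<beta> e N UNIV v"
    unfolding norm_XY_def Let_def by (rule le, simp)+
qed

text \<open>The weight N^(1/2) on the first projection norm is common to X and Y, so all four
  exponents stay free and one statement covers the first three bounds. Equal innermost exponents
  with \<theta> = 1/2 mean that nothing is interpolated.\<close>

lemma bilinear_XY:
  fixes hp hm :: "real \<times> (real^'n::{finite,linorder}) \<Rightarrow> complex"
  assumes hp: "hp \<in> borel_measurable lebesgue" and hm: "hm \<in> borel_measurable lebesgue"
    and e: "0 < e" "e < 1" and N: "Np > 0" "Nm > 0"
  shows "norm_LtLx 2 2 UNIV (\<lambda>z. hp z * hm z)
    \<le> ennreal (real CARD('n) / (real Np powr (1 / 2) * real Nm powr \<alpha>'))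
      * (norm_XY \<alpha> \<beta> e Np UNIV hp * norm_XY \<alpha>' \<beta>' e Nm UNIV hm)"
proof (rule bilinear_bound [OF hp hm])
  show "1 / (2 / e) + 1 / (2 / (1 - e)) = 1 / 2" "1 / (2 / (1 - e)) + 1 / (2 / e) = 1 / 2"
    "(1 / 2) / (2 / (1 - e)) + (1 - 1 / 2) / (2 / (1 - e)) + 1 / (2 / e) = 1 / 2"
    using e by (simp_all add: field_simps)
qed (use e N norm_XY_bounds in auto)

text \<open>The integrability exponent of \<open>U\<^sub>l h\<^sub>+\<close> dual to \<open>\<c>\<^sub>0 / (1 - e)\<close> lies between \<open>2 / (1 - e)\<close>
  and \<open>2 / e\<close>; the two norms carry the same power of \<open>N\<^sub>+\<close> when \<open>\<beta> = 1 / 2\<close>.\<close>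

lemma bilinear_XY_interpolated:
  fixes hp hm :: "real \<times> (real^'n::{finite,linorder}) \<Rightarrow> complex"
  assumes hp: "hp \<in> borel_measurable lebesgue" and hm: "hm \<in> borel_measurable lebesgue"
    and e: "0 < e" "e < 1 / 3" and N: "Np > 0" "Nm > 0" and d: "CARD('n) \<ge> 3"
  shows "norm_LtLx 2 2 UNIV (\<lambda>z. hp z * hm z)
    \<le> ennreal (real CARD('n) / (real Np powr (1 / 2) * real Nm powr (- 1 / 2)))
      * (norm_XY \<alpha> (1 / 2) e Np UNIV hp * norm_XY \<alpha>' \<beta>' e Nm UNIV hm)"
proof -
  define d where "d = real CARD('n)"
  have d3: "d \<ge> 3" using assms(7) by (simp add: d_def)
  \<comment> \<open>The solution of \<theta> (1-e)/2 + (1-\<theta>) e/2 + (1-e)(d-2)/(2(d-1)) = 1/2,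
    the scaling relation of the innermost level.\<close>
  define \<theta> where "\<theta> = (1 - e) / ((d - 1) * (1 - 2 * e))"
  have pos: "(d - 1) * (1 - 2 * e) > 0" using d3 e by simp
  \<comment> \<open>This is e < 1/3, and d - 1 \<ge> 2 then yields \<theta> < 1; dimension 3 is the
    extreme case.\<close>
  have "1 - e < 2 * (1 - 2 * e)" using e by simp
  also have "\<dots> \<le> (d - 1) * (1 - 2 * e)" using d3 e by (intro mult_right_mono) auto
  finally have \<theta>: "0 < \<theta>" "\<theta> < 1" using pos e by (auto simp: \<theta>_def)
  have "\<theta> / (2 / (1 - e)) + (1 - \<theta>) / (2 / e) = (\<theta> * (1 - 2 * e) + e) / 2"
    by (simp add: algebra_simps flip: add_divide_distrib diff_divide_distrib)
  also have "\<theta> * (1 - 2 * e) = (1 - e) / (d - 1)" using e d3 by (simp add: \<theta>_def)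
  also have "((1 - e) / (d - 1) + e) / 2 + 1 / (2 * (d - 1) / (d - 2) / (1 - e)) = 1 / 2"
  proof -
    have "(1 - e) / (d - 1) + (1 - e) * (d - 2) / (d - 1) = 1 - e"
      using d3 by (simp flip: add_divide_distrib) (simp add: field_simps)
    moreover have "1 / (2 * (d - 1) / (d - 2) / (1 - e)) = ((1 - e) * (d - 2) / (d - 1)) / 2"
      by (simp add: mult.commute)
    moreover have "(A + e) / 2 + r = 1 / 2" if "A + B = 1 - e" "r = B / 2" for A B r :: real
      using that by (simp add: field_simps)
    ultimately show ?thesis by blast
  qed
  finally have sum: "\<theta> / (2 / (1 - e)) + (1 - \<theta>) / (2 / e) + 1 / (2 * (d - 1) / (d - 2) / (1 - e)) = 1 / 2"
    by simp
  show ?thesis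
  proof (rule bilinear_bound [OF hp hm])
    show "1 / (2 / e) + 1 / (2 / (1 - e)) = 1 / 2" "1 / (2 / (1 - e)) + 1 / (2 / e) = 1 / 2"
      using e by (simp_all add: field_simps)
    show "\<theta> / (2 / (1 - e)) + (1 - \<theta>) / (2 / e)
        + 1 / (2 * (real CARD('n) - 1) / (real CARD('n) - 2) / (1 - e)) = 1 / 2"
      using sum by (simp add: d_def)
    show "2 * (real CARD('n) - 1) / (real CARD('n) - 2) / (1 - e) > 0"
      using d3 e by (simp add: d_def)
  qed (use e N \<theta> norm_XY_bounds in auto)
qed

theorem lemma4p1:
  assumes "CARD('n::{finite,linorder}) \<ge> 3"
  shows "\<exists>eps_max::real. \<exists>eps0_max C :: real \<Rightarrow> real.
    eps_max > 0 \<and> (\<forall>\<epsilon>>0. eps0_max \<epsilon> > 0) \<and> (\<forall>\<epsilon>0>0. C \<epsilon>0 > 0) \<and>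
    (\<forall>\<epsilon> \<epsilon>0. 0 < \<epsilon> \<longrightarrow> \<epsilon> \<le> eps_max \<longrightarrow> 0 < \<epsilon>0 \<longrightarrow> \<epsilon>0 \<le> eps0_max \<epsilon> \<longrightarrow> \<epsilon>0 < 1 / 2 ^ 100 \<longrightarrow>
      (\<forall>(hp :: real \<times> (real^'n::{finite,linorder}) \<Rightarrow> complex) (hm :: real \<times> (real^'n::{finite,linorder}) \<Rightarrow> complex) (Np::nat) (Nm::nat).
        hp \<in> borel_measurable lebesgue \<longrightarrow> hm \<in> borel_measurable lebesgue \<longrightarrow>
        Np \<in> dyadic \<longrightarrow> Nm \<in> dyadic \<longrightarrow> Np \<ge> Nm \<longrightarrow>
        (let s_c = (real CARD('n::{finite,linorder}) - 2) / 2;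
             L = norm_LtLx 2 2 UNIV (\<lambda>z. hp z * hm z);
             K = ennreal (C \<epsilon>0 * real Np powr \<epsilon> * (real Np / real Nm) powr (- 1 / 2))
         in L \<le> K * (ennreal (real Nm powr s_c) * norm_X \<epsilon>0 Np UNIV hp * norm_X \<epsilon>0 Nm UNIV hm) \<and>
            L \<le> K * (norm_Y \<epsilon>0 Np UNIV hp * norm_Y \<epsilon>0 Nm UNIV hm) \<and>
            L \<le> K * (norm_X \<epsilon>0 Np UNIV hp * norm_Y \<epsilon>0 Nm UNIV hm) \<and>
            L \<le> K * (norm_Y \<epsilon>0 Np UNIV hp * norm_X \<epsilon>0 Nm UNIV hm))))"
\<comment> \<open>1/4 is a convenient value below the threshold 1/3 of the interpolated bound; the
  constant d is the number of frequency pieces.\<close>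
proof (rule exI [of _ 1], rule exI [of _ "\<lambda>_. 1 / 4"], rule exI [of _ "\<lambda>_. real CARD('n)"],
    intro conjI allI impI)
  fix \<epsilon> e :: real and hp hm :: "real \<times> (real^'n::{finite,linorder}) \<Rightarrow> complex" and Np Nm :: nat
  assume \<epsilon>: "0 < \<epsilon>" and e: "0 < e" "e \<le> 1 / 4"
    and hp: "hp \<in> borel_measurable lebesgue" and hm: "hm \<in> borel_measurable lebesgue"
    and N: "Np \<in> dyadic" "Nm \<in> dyadic"
  from N have N: "Np > 0" "Nm > 0" "Np \<ge> 1" by (auto simp: dyadic_def)
  define d where "d = real CARD('n)"
  have e': "e < 1 / 3" "e < 1" using e by auto
  let ?L = "norm_LtLx 2 2 UNIV (\<lambda>z. hp z * hm z)"
  let ?K = "ennreal (d * real Np powr \<epsilon> * (real Np / real Nm) powr (- 1 / 2))"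
  \<comment> \<open>\<open>s\<close> is the extra power of N_-: (d-2)/2 when both functions are
    measured in X, and 0 otherwise. Apart from N_+^\<epsilon> \<ge> 1 this is an identity between
    powers.\<close>
  have K: "ennreal (d / (real Np powr (1 / 2) * real Nm powr (- 1 / 2 - s))) \<le> ?K * ennreal (real Nm powr s)" for s
  proof -
    have "real Nm powr (- (1 / 2 + s)) = 1 / (real Nm powr (1 / 2) * real Nm powr s)"
      by (simp only: powr_minus_divide powr_add)
    moreover have "- 1 / 2 - s = - (1 / 2 + s)" by simp
    ultimately have 1: "real Nm powr (- 1 / 2 - s) = 1 / (real Nm powr (1 / 2) * real Nm powr s)"
      by simp
    have "(real Np / real Nm) powr (- (1 / 2)) = real Nm powr (1 / 2) / real Np powr (1 / 2)"
      using N by (simp only: powr_minus_divide powr_divide of_nat_0_le_iff) simp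
    then have 2: "(real Np / real Nm) powr (- 1 / 2) = real Nm powr (1 / 2) / real Np powr (1 / 2)"
      by simp
    have "d / (real Np powr (1 / 2) * real Nm powr (- 1 / 2 - s))
        = d * 1 * (real Np / real Nm) powr (- 1 / 2) * real Nm powr s"
      unfolding 1 2 by simp
    also have "\<dots> \<le> d * real Np powr \<epsilon> * (real Np / real Nm) powr (- 1 / 2) * real Nm powr s"
      using N \<epsilon> by (intro mult_right_mono mult_left_mono ge_one_powr_ge_zero) (auto simp: d_def)
    finally show ?thesis by (simp add: ennreal_leI d_def flip: ennreal_mult)
  qed
  have bound: "?L \<le> ?K * (ennreal (real Nm powr s) * P * Q)"
    if "?L \<le> ennreal (real CARD('n) / (real Np powr (1 / 2) * real Nm powr (- 1 / 2 - s))) * (P * Q)" for s P Q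
  proof -
    note that
    also have "ennreal (real CARD('n) / (real Np powr (1 / 2) * real Nm powr (- 1 / 2 - s))) * (P * Q)
        \<le> (?K * ennreal (real Nm powr s)) * (P * Q)"
      using K [of s] unfolding d_def by (rule mult_right_mono) simp
    finally show ?thesis by (simp only: mult.assoc)
  qed
  have bound0: "?L \<le> ?K * (P * Q)"
    if "?L \<le> ennreal (real CARD('n) / (real Np powr (1 / 2) * real Nm powr (- 1 / 2))) * (P * Q)" for P Q
    using bound [of 0 P Q] that N by simp
  \<comment> \<open>The weight of X on the norm of h_- is N_-^(-1/2) times N_-^(-s_c), which is
    where the factor N_-^(s_c) of the first bound originates.\<close>
  have s: "- (real CARD('n) - 1) / 2 = - 1 / 2 - (real CARD('n) - 2) / 2" by (simp add: field_simps)
  have "?L \<le> ?K * (ennreal (real Nm powr ((real CARD('n) - 2) / 2)) * norm_X e Np UNIV hp * norm_X e Nm UNIV hm)"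
    unfolding norm_X_def s by (intro bound bilinear_XY hp hm e e' N)
  moreover have "?L \<le> ?K * (norm_Y e Np UNIV hp * norm_Y e Nm UNIV hm)"
    "?L \<le> ?K * (norm_X e Np UNIV hp * norm_Y e Nm UNIV hm)"
    unfolding norm_X_def norm_Y_def by (intro bound0 bilinear_XY hp hm e e' N)+
  moreover have "?L \<le> ?K * (norm_Y e Np UNIV hp * norm_X e Nm UNIV hm)"
    unfolding norm_X_def norm_Y_def by (intro bound0 bilinear_XY_interpolated hp hm e e' N assms)
  ultimately show "let s_c = (real CARD('n::{finite,linorder}) - 2) / 2;
             L = norm_LtLx 2 2 UNIV (\<lambda>z. hp z * hm z);
             K = ennreal (real CARD('n) * real Np powr \<epsilon> * (real Np / real Nm) powr (- 1 / 2))
         in L \<le> K * (ennreal (real Nm powr s_c) * norm_X e Np UNIV hp * norm_X e Nm UNIV hm) \<and>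
            L \<le> K * (norm_Y e Np UNIV hp * norm_Y e Nm UNIV hm) \<and>
            L \<le> K * (norm_X e Np UNIV hp * norm_Y e Nm UNIV hm) \<and>
            L \<le> K * (norm_Y e Np UNIV hp * norm_X e Nm UNIV hm)"
    unfolding Let_def d_def by blast
qed simp_all

end
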